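(* Let $k\geq 6$ be an integer and let $G=K_{4,3*2,2*(k-6),1*3}$, i.e. the complete $k$-partite graph having exactly one part of size $4$, two parts of size $3$, $k-6$ parts of size $2$, and three parts of size $1$. Then $Ch(G)=k$.
   Context: Graphs are finite and simple. A complete multipartite graph is one whose vertex set is partitioned into parts such that two vertices are adjacent if and only if they lie in different parts. In the notation $K_{\ldots}$, an entry $r*s$ means that there are $s$ parts of size $r$, and an entry $r$ alone means one part of size $r$. For a graph $G=(V,E)$, a list assignment $L$ assigns to each vertex $u\in V$ a set $L(u)$ of colors; it is a $k$-list assignment if $|L(u)|\geq k$ for every $u\in V$. An $L$-coloring of $G$ is a coloring in which each vertex $u$ receives a color from $L(u)$ and adjacent vertices receive different colors. $G$ is $L$-colorable if it has an $L$-coloring. $G$ is $k$-choosable if it is $L$-colorable for every $k$-list assignment $L$. The choice number $Ch(G)$ is the smallest integer $k$ such that $G$ is $k$-choosable. *)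

theory Defs
  imports Main "HOL-Library.Disjoint_Sets" "HOL-Library.Multiset"
begin

definition simple_graph :: "'a set \<Rightarrow> 'a set set \<Rightarrow> bool" where
  "simple_graph V E \<longleftrightarrow> finite V \<and> (\<forall>e\<in>E. e \<subseteq> V \<and> card e = 2)"

(* The multiset M records the sizes of all parts, so r*s in the K-notation is
   replicate_mset s r.  Parts are nonempty, as in any partition_on. *)
definition complete_multipartite :: "'a set \<Rightarrow> 'a set set \<Rightarrow> nat multiset \<Rightarrow> bool" where
  "complete_multipartite V E M \<longleftrightarrow> simple_graph V E \<and>
     (\<exists>P. partition_on V P \<and> image_mset card (mset_set P) = M \<and>
       (\<forall>u\<in>V. \<forall>v\<in>V. {u, v} \<in> E \<longleftrightarrow> \<not> (\<exists>p\<in>P. u \<in> p \<and> v \<in> p)))"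

(* Colors are natural numbers: a finite graph never needs more than a countable supply.
   Lists may be infinite; card is 0 on infinite sets, hence the explicit disjunct. *)
definition list_assignment :: "'a set \<Rightarrow> nat \<Rightarrow> ('a \<Rightarrow> nat set) \<Rightarrow> bool" where
  "list_assignment V k L \<longleftrightarrow> (\<forall>u\<in>V. infinite (L u) \<or> k \<le> card (L u))"

definition list_coloring ::
    "'a set \<Rightarrow> 'a set set \<Rightarrow> ('a \<Rightarrow> nat set) \<Rightarrow> ('a \<Rightarrow> nat) \<Rightarrow> bool" where
  "list_coloring V E L c \<longleftrightarrow>
     (\<forall>u\<in>V. c u \<in> L u) \<and> (\<forall>u\<in>V. \<forall>v\<in>V. {u, v} \<in> E \<longrightarrow> c u \<noteq> c v)"

definition list_colorable :: "'a set \<Rightarrow> 'a set set \<Rightarrow> ('a \<Rightarrow> nat set) \<Rightarrow> bool" where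
  "list_colorable V E L \<longleftrightarrow> (\<exists>c. list_coloring V E L c)"

definition choosable :: "'a set \<Rightarrow> 'a set set \<Rightarrow> nat \<Rightarrow> bool" where
  "choosable V E k \<longleftrightarrow> (\<forall>L. list_assignment V k L \<longrightarrow> list_colorable V E L)"

(* Every finite simple graph is choosable for k = card V, so the minimum exists. *)
definition choice_number :: "'a set \<Rightarrow> 'a set set \<Rightarrow> nat" where
  "choice_number V E = (LEAST k. choosable V E k)"

end

theory Submission imports Defs begin

text \<open>
  Take a counterexample, minimal in the number of vertices among the induced subgraphs that arise, with
  all lists of size \<open>k\<close>. A maximal Hall violator shows that fewer colors than vertices occur, and
  by induction no color is common to all lists of a part with at least two vertices. Hence a part of
  size two already forces \<open>2 * k\<close> colors. In each part of size three or four some vertices with a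
  common color are merged, leaving two classes, and Hall's condition is checked for the classes. A set
  with at most one class from each part has at most \<open>k\<close> elements; every large part contributing
  both its classes adds one element, but those two classes together see more than \<open>k\<close> colors. If
  all \<open>2 * k\<close> colors occur, the graph is the full one with \<open>2 * k + 1\<close> vertices, and the
  merging has to be chosen more carefully.
\<close>

text \<open>The counting is tight for the full graph. A set of classes can exceed \<open>k\<close>
  by one for every part that contributes both its classes, and this surplus has to be paid for by
  colors. Two classes of a part have no common color, so a class keeping a whole list pays
  \<open>k\<close> and its partner pays the surplus. With fewer than \<open>2 * k\<close> colors
  this suffices: no part of size two is left, and in a part of size four some three lists share a
  color. With exactly \<open>2 * k\<close> colors every color may lie in exactly two of the four
  lists. Then only two pairs can be merged, neither class need have \<open>k\<close> colors, and the
  pair of classes may see as few as four. A set of \<open>k + 1\<close> classes with such a pair as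
  its only surplus must meet every part, in particular a part \<open>{t}\<close>, and the list of
  \<open>t\<close> supplies the missing colors. This is why the pairing is chosen relative to that
  list, and why parts of size one matter. The numbers 2, 3 and \<open>k + 3\<close> required for the
  two parts of size three come from the possible surpluses 1, 2 and 3, and from small sets
  consisting of merged classes only.\<close>

section \<open>Hall's theorem and part colorings\<close>

text \<open>Induction on \<open>card J\<close>. A tight proper nonempty \<open>S\<close> is matched
  separately; removing its colors keeps Hall's condition on \<open>J - S\<close>, because
  \<open>S \<union> T\<close> satisfies it. If there is no tight set, every nonempty proper subset
  has a color to spare, so any \<open>x\<close> may take any of its colors. An indexed family is
  used because different vertices may have equal lists.\<close>

theorem hall_marriage:
  fixes A :: "'j \<Rightarrow> 'c set"
  assumes "finite J" "\<And>j. j \<in> J \<Longrightarrow> finite (A j)"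
    and "\<And>S. S \<subseteq> J \<Longrightarrow> card S \<le> card (\<Union>(A ` S))"
  shows "\<exists>g. inj_on g J \<and> (\<forall>j\<in>J. g j \<in> A j)"
  using assms
proof (induction "card J" arbitrary: J A rule: less_induct)
  case less
  note fin = less.prems(1,2) and hall = less.prems(3)
  show ?case
  proof (cases "\<exists>S. S \<subset> J \<and> S \<noteq> {} \<and> card S = card (\<Union>(A ` S))")
    case True
    then obtain S where S: "S \<subset> J" "S \<noteq> {}" "card S = card (\<Union>(A ` S))" by blast
    let ?N = "\<Union>(A ` S)"
    have "finite S" using S(1) fin(1) by (meson finite_subset psubset_imp_subset)
    then have finS: "finite S" "finite ?N" using S(1) fin(2) by auto
    have "card S < card J" using S(1) fin(1) by (simp add: psubset_card_mono)
    moreover have "finite (A j)" if "j \<in> S" for j using S(1) fin(2) that by blast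
    moreover have "card T \<le> card (\<Union>(A ` T))" if "T \<subseteq> S" for T
      using S(1) that by (intro hall[of T]) blast
    ultimately obtain g where g: "inj_on g S" "\<forall>j\<in>S. g j \<in> A j"
      using less.hyps[of S A] finS(1) by auto
    have "card (J - S) < card J" using S fin(1) by (intro psubset_card_mono) auto
    moreover have "card T \<le> card (\<Union>((\<lambda>j. A j - ?N) ` T))" if T: "T \<subseteq> J - S" for T
    proof -
      have "finite T" using T fin(1) by (meson finite_Diff finite_subset)
      then have finT: "finite T" "finite (\<Union>(A ` T))" using T fin(2) by auto
      have "card S + card T = card (S \<union> T)"
        using T finS finT by (subst card_Un_disjoint) auto
      also have "\<dots> \<le> card (\<Union>(A ` (S \<union> T)))" using T S(1) by (intro hall[of "S \<union> T"]) blast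
      also have "\<Union>(A ` (S \<union> T)) = ?N \<union> \<Union>((\<lambda>j. A j - ?N) ` T)" by auto
      also have "card \<dots> = card ?N + card (\<Union>((\<lambda>j. A j - ?N) ` T))"
        using finS finT by (subst card_Un_disjoint) (auto intro: finite_subset[OF _ finT(2)])
      finally show ?thesis using S(3) by simp
    qed
    ultimately obtain g' where g': "inj_on g' (J - S)" "\<forall>j\<in>J - S. g' j \<in> A j - ?N"
      using less.hyps[of "J - S" "\<lambda>j. A j - ?N"] fin by auto
    let ?h = "\<lambda>j. if j \<in> S then g j else g' j"
    have "inj_on ?h J"
    proof (rule inj_onI)
      fix x y assume xy: "x \<in> J" "y \<in> J" "?h x = ?h y"
      have "g u \<noteq> g' w" if "u \<in> S" "w \<in> J - S" for u w using g(2) g'(2) that by force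
      then show "x = y" using g(1) g'(1) xy
        by (cases "x \<in> S"; cases "y \<in> S") (auto simp: inj_on_def, metis+)
    qed
    then show ?thesis using g g' by (intro exI[of _ ?h]) auto
  next
    case no_tight: False
    show ?thesis
    proof (cases "J = {}")
      case True
      then show ?thesis by auto
    next
      case False
      then obtain x where x: "x \<in> J" by blast
      have "card {x} \<le> card (\<Union>(A ` {x}))" using x by (intro hall[of "{x}"]) blast
      then obtain c where c: "c \<in> A x" by fastforce
      have "card T \<le> card (\<Union>((\<lambda>j. A j - {c}) ` T))" if T: "T \<subseteq> J - {x}" for T
      proof (cases "T = {}")
        case nonempty: False
        have "T \<subset> J" using T x by auto
        then have "card T \<noteq> card (\<Union>(A ` T))" using nonempty no_tight by auto
        moreover have "card T \<le> card (\<Union>(A ` T))" using \<open>T \<subset> J\<close> by (intro hall[of T]) blast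
        moreover have "(\<Union>((\<lambda>j. A j - {c}) ` T)) = \<Union>(A ` T) - {c}" by auto
        ultimately show ?thesis by (auto simp: card_Diff_singleton_if)
      qed simp
      moreover have "card (J - {x}) < card J" using x fin(1) by (intro card_Diff1_less)
      ultimately obtain g where g: "inj_on g (J - {x})" "\<forall>j\<in>J - {x}. g j \<in> A j - {c}"
        using less.hyps[of "J - {x}" "\<lambda>j. A j - {c}"] fin by auto
      have "inj_on (g(x := c)) J"
        using g by (auto simp: inj_on_def)
      then show ?thesis using g c by (intro exI[of _ "g(x := c)"]) auto
    qed
  qed
qed

text \<open>Parts may be empty, so that an induced subgraph is given by the same index set.\<close>

definition parts_colorable :: "'i set \<Rightarrow> ('i \<Rightarrow> 'a set) \<Rightarrow> ('a \<Rightarrow> 'c set) \<Rightarrow> bool" where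
  "parts_colorable I X L \<longleftrightarrow> (\<exists>c. (\<forall>i\<in>I. \<forall>v\<in>X i. c v \<in> L v) \<and>
     (\<forall>i\<in>I. \<forall>j\<in>I. i \<noteq> j \<longrightarrow> (\<forall>u\<in>X i. \<forall>v\<in>X j. c u \<noteq> c v)))"

lemma parts_colorable_mono:
  assumes "parts_colorable I X L" "\<And>i v. i \<in> I \<Longrightarrow> v \<in> X i \<Longrightarrow> L v \<subseteq> L' v"
  shows "parts_colorable I X L'"
proof -
  obtain c where "\<forall>i\<in>I. \<forall>v\<in>X i. c v \<in> L v"
    "\<forall>i\<in>I. \<forall>j\<in>I. i \<noteq> j \<longrightarrow> (\<forall>u\<in>X i. \<forall>v\<in>X j. c u \<noteq> c v)"
    using assms(1) unfolding parts_colorable_def by blast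
  moreover have "c v \<in> L' v" if "i \<in> I" "v \<in> X i" for i v
    using assms(2)[OF that] \<open>\<forall>i\<in>I. \<forall>v\<in>X i. c v \<in> L v\<close> that by blast
  ultimately show ?thesis
    unfolding parts_colorable_def by (intro exI[of _ c]) simp
qed

lemma card_colors_less:
  fixes L :: "'a \<Rightarrow> 'c set"
  assumes disj: "disjoint_family_on X I" and finW: "finite (\<Union>(X ` I))"
    and finL: "\<And>v. v \<in> \<Union>(X ` I) \<Longrightarrow> finite (L v)"
    and nc: "\<not> parts_colorable I X L"
    and minimal: "\<And>S. S \<subset> \<Union>(X ` I) \<Longrightarrow> parts_colorable I (\<lambda>i. X i \<inter> S) L"
  shows "card (\<Union>(L ` \<Union>(X ` I))) < card (\<Union>(X ` I))"
proof (rule ccontr)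
  let ?W = "\<Union>(X ` I)"
  assume "\<not> ?thesis"
  then have CW: "card ?W \<le> card (\<Union>(L ` ?W))" by simp
  let ?d = "\<lambda>S. int (card S) - int (card (\<Union>(L ` S)))"
  have "?W \<noteq> {}" using nc unfolding parts_colorable_def by fastforce
  then have "finite {S. S \<subset> ?W}" "{} \<in> {S. S \<subset> ?W}" using finW
    by (auto intro: finite_subset[of _ "Pow ?W"])
  then have "Max (?d ` {S. S \<subset> ?W}) \<in> ?d ` {S. S \<subset> ?W}"
    "\<And>T. T \<subset> ?W \<Longrightarrow> ?d T \<le> Max (?d ` {S. S \<subset> ?W})"
    by (auto intro!: Max_in Max_ge)
  then obtain S where S: "S \<subset> ?W" "\<And>T. T \<subset> ?W \<Longrightarrow> ?d T \<le> ?d S"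
    by (metis (no_types, lifting) imageE mem_Collect_eq)
  \<comment> \<open>The empty set has deficiency 0, and by \<open>CW\<close> the whole set has
    deficiency at most 0. Hence \<open>S\<close> is maximal among all subsets, which is needed when
    \<open>S \<union> T\<close> is everything.\<close>
  have d0: "0 \<le> ?d S" using S(2)[of "{}"] \<open>?W \<noteq> {}\<close> by auto
  have dT: "?d T \<le> ?d S" if "T \<subseteq> ?W" for T
    using S(2)[of T] that CW d0 by (cases "T = ?W") auto
  let ?N = "\<Union>(L ` S)"
  have "finite S" using S(1) finW by (meson finite_subset psubset_imp_subset)
  moreover have "finite (L v)" if "v \<in> S" for v using S(1) finL that by blast
  ultimately have finS: "finite S" "finite ?N" by auto
  \<comment> \<open>A violating \<open>T\<close> outside \<open>S\<close> would make the deficiency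
    of \<open>S \<union> T\<close> larger than that of \<open>S\<close>.\<close>
  have "\<exists>g. inj_on g (?W - S) \<and> (\<forall>j\<in>?W - S. g j \<in> L j - ?N)"
  proof (rule hall_marriage)
    show "finite (?W - S)" using finW by blast
    show "finite (L j - ?N)" if "j \<in> ?W - S" for j using finL that by auto
    fix T assume T: "T \<subseteq> ?W - S"
    have "finite T" using T finW by (meson finite_Diff finite_subset)
    moreover have "finite (L v)" if "v \<in> T" for v using T finL that by blast
    ultimately have finT: "finite T" "finite (\<Union>(L ` T))" by auto
    have "?d (S \<union> T) \<le> ?d S" using T S(1) by (intro dT) auto
    moreover have "card (S \<union> T) = card S + card T"
      using T finS finT by (subst card_Un_disjoint) auto
    moreover have "\<Union>(L ` (S \<union> T)) = ?N \<union> \<Union>((\<lambda>j. L j - ?N) ` T)" by auto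
    moreover have "card (?N \<union> \<Union>((\<lambda>j. L j - ?N) ` T)) = card ?N + card (\<Union>((\<lambda>j. L j - ?N) ` T))"
      using finS finT by (subst card_Un_disjoint) (auto intro: finite_subset[OF _ finT(2)])
    ultimately show "card T \<le> card (\<Union>((\<lambda>j. L j - ?N) ` T))" by simp
  qed
  then obtain g where g: "inj_on g (?W - S)" "\<forall>j\<in>?W - S. g j \<in> L j - ?N" by blast
  obtain c where c: "\<forall>i\<in>I. \<forall>v\<in>X i \<inter> S. c v \<in> L v"
    "\<forall>i\<in>I. \<forall>j\<in>I. i \<noteq> j \<longrightarrow> (\<forall>u\<in>X i \<inter> S. \<forall>v\<in>X j \<inter> S. c u \<noteq> c v)"
    using minimal[OF S(1)] unfolding parts_colorable_def by blast
  let ?h = "\<lambda>v. if v \<in> S then c v else g v"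
  have "?h u \<noteq> ?h v" if "i \<in> I" "j \<in> I" "i \<noteq> j" "u \<in> X i" "v \<in> X j" for i j u v
  proof -
    have uv: "u \<noteq> v" using that disj by (auto simp: disjoint_family_on_def)
    have mem: "u \<in> ?W" "v \<in> ?W" using that by auto
    have cu: "c u \<in> ?N" if "u \<in> S" using c(1) that \<open>i \<in> I\<close> \<open>u \<in> X i\<close> by blast
    have cv: "c v \<in> ?N" if "v \<in> S" using c(1) that \<open>j \<in> I\<close> \<open>v \<in> X j\<close> by blast
    have gu: "g u \<notin> ?N" if "u \<notin> S" using g(2) mem that by blast
    have gv: "g v \<notin> ?N" if "v \<notin> S" using g(2) mem that by blast
    show ?thesis
    proof (cases "u \<in> S"; cases "v \<in> S")
      assume "u \<in> S" "v \<in> S"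
      then show ?thesis using c(2) that by simp
    next
      assume "u \<in> S" "v \<notin> S"
      then show ?thesis using cu gv by metis
    next
      assume "u \<notin> S" "v \<in> S"
      then show ?thesis using gu cv by metis
    next
      assume "u \<notin> S" "v \<notin> S"
      then show ?thesis using g(1) mem uv by (simp add: inj_on_eq_iff)
    qed
  qed
  moreover have "?h v \<in> L v" if "i \<in> I" "v \<in> X i" for i v
    using that c(1) g(2) by auto
  ultimately have "parts_colorable I X L"
    unfolding parts_colorable_def by (intro exI[of _ ?h]) blast
  with nc show False ..
qed

lemma parts_colorable_remove_part:
  assumes "parts_colorable (I - {i}) X (\<lambda>v. L v - {c})" "\<And>v. v \<in> X i \<Longrightarrow> c \<in> L v"
    "disjoint_family_on X I" "i \<in> I"
  shows "parts_colorable I X L"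
proof -
  obtain f where f: "\<forall>j\<in>I - {i}. \<forall>v\<in>X j. f v \<in> L v - {c}"
    "\<forall>j\<in>I - {i}. \<forall>j'\<in>I - {i}. j \<noteq> j' \<longrightarrow> (\<forall>u\<in>X j. \<forall>v\<in>X j'. f u \<noteq> f v)"
    using assms(1) unfolding parts_colorable_def by blast
  let ?h = "\<lambda>v. if v \<in> X i then c else f v"
  have "?h u \<noteq> ?h v" if "j \<in> I" "j' \<in> I" "j \<noteq> j'" "u \<in> X j" "v \<in> X j'" for j j' u v
  proof -
    have other: "w \<notin> X i" if "l \<in> I" "w \<in> X l" "l \<noteq> i" for l w
      using assms(3,4) that by (auto simp: disjoint_family_on_def)
    have fw: "f w \<noteq> c" if "l \<in> I" "w \<in> X l" "l \<noteq> i" for l w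
      using f(1) that by auto
    consider "j = i" "j' \<noteq> i" | "j \<noteq> i" "j' = i" | "j \<noteq> i" "j' \<noteq> i" using \<open>j \<noteq> j'\<close> by blast
    then show ?thesis
    proof cases
      case 1
      then show ?thesis using other[of j' v] fw[of j' v] that by simp
    next
      case 2
      then show ?thesis using other[of j u] fw[of j u] that by simp
    next
      case 3
      then show ?thesis using other[of j u] other[of j' v] f(2) that by simp
    qed
  qed
  moreover have "?h v \<in> L v" if "j \<in> I" "v \<in> X j" for j v
    using that f assms(2) by auto
  ultimately show ?thesis
    unfolding parts_colorable_def by (intro exI[of _ ?h]) blast
qed

lemma parts_colorable_if_classes:
  fixes K :: "'i \<Rightarrow> 'a set set" and L :: "'a \<Rightarrow> 'c set"
  assumes disj: "disjoint_family_on X I"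
    and K: "\<And>i. i \<in> I \<Longrightarrow> \<Union>(K i) = X i" "\<And>i. i \<in> I \<Longrightarrow> {} \<notin> K i"
    and fin: "finite (\<Union>(X ` I))" "\<And>v. v \<in> \<Union>(X ` I) \<Longrightarrow> finite (L v)"
    and hall: "\<And>S. S \<subseteq> \<Union>(K ` I) \<Longrightarrow> card S \<le> card (\<Union>q\<in>S. \<Inter>(L ` q))"
  shows "parts_colorable I X L"
proof -
  have "\<Union>(K ` I) \<subseteq> Pow (\<Union>(X ` I))" using K by blast
  then have "finite (\<Union>(K ` I))" using fin(1) by (meson finite_Pow_iff finite_subset)
  moreover have "finite (\<Inter>(L ` q))" if q: "q \<in> \<Union>(K ` I)" for q
  proof -
    obtain i where i: "i \<in> I" "q \<in> K i" using q by blast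
    then obtain v where "v \<in> q" using K(2) by fastforce
    moreover from this have "v \<in> \<Union>(X ` I)" using i K(1) by blast
    ultimately
    show ?thesis using fin(2) by (meson INT_lower finite_subset)
  qed
  ultimately obtain g where g: "inj_on g (\<Union>(K ` I))" "\<forall>q\<in>\<Union>(K ` I). g q \<in> \<Inter>(L ` q)"
    using hall_marriage[of "\<Union>(K ` I)" "\<lambda>q. \<Inter>(L ` q)"] hall by blast
  have "\<exists>q. \<forall>i\<in>I. v \<in> X i \<longrightarrow> q \<in> K i \<and> v \<in> q" for v
  proof (cases "\<exists>i\<in>I. v \<in> X i")
    case True
    then obtain i where i: "i \<in> I" "v \<in> X i" by blast
    then have "j = i" if "j \<in> I" "v \<in> X j" for j
      using disj that by (auto simp: disjoint_family_on_def)
    then show ?thesis using i K(1) by blast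
  qed blast
  then obtain Q where Q: "\<And>i v. i \<in> I \<Longrightarrow> v \<in> X i \<Longrightarrow> Q v \<in> K i \<and> v \<in> Q v" by metis
  have "g (Q v) \<in> L v" if "i \<in> I" "v \<in> X i" for i v
    using g(2) Q[OF that] that(1) by blast
  moreover have "g (Q u) \<noteq> g (Q v)" if "i \<in> I" "j \<in> I" "i \<noteq> j" "u \<in> X i" "v \<in> X j" for i j u v
  proof -
    have "Q u \<in> K i" "Q v \<in> K j" "u \<in> Q u" using Q that by auto
    moreover from this have "u \<in> X i" "Q v \<subseteq> X j" using K(1) that by blast+
    ultimately have "Q u \<noteq> Q v" using disj that by (auto simp: disjoint_family_on_def)
    then show ?thesis using g(1) \<open>Q u \<in> K i\<close> \<open>Q v \<in> K j\<close> that by (meson UN_I inj_onD)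
  qed
  ultimately show ?thesis
    unfolding parts_colorable_def by (intro exI[of _ "\<lambda>v. g (Q v)"]) blast
qed

section \<open>Hall's condition for merged classes\<close>

text \<open>Every index contributes at most one element to \<open>S\<close>, and one more exactly
  when it has two classes and both lie in \<open>S\<close>.\<close>

lemma card_le_index_plus_full:
  assumes "finite I" "\<And>i. i \<in> I \<Longrightarrow> finite (K i) \<and> card (K i) \<le> 2" "S \<subseteq> \<Union>(K ` I)"
  shows "card S \<le> card I + card {i\<in>I. card (K i) = 2 \<and> K i \<subseteq> S}"
proof -
  let ?D = "{i\<in>I. card (K i) = 2 \<and> K i \<subseteq> S}"
  have S: "S = (\<Union>i\<in>I. S \<inter> K i)" using assms(3) by blast
  have le: "card (S \<inter> K i) \<le> 1 + of_bool (card (K i) = 2 \<and> K i \<subseteq> S)" if "i \<in> I" for i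
  proof -
    have Ki: "finite (K i)" "card (K i) \<le> 2" using assms(2) that by blast+
    show ?thesis
    proof (cases "card (S \<inter> K i) = card (K i)")
      case True
      then have "S \<inter> K i = K i" using Ki(1) by (intro card_subset_eq) auto
      then have KS: "K i \<subseteq> S" by blast
      show ?thesis
      proof (cases "card (K i) = 2")
        case two: True
        then have "of_bool (card (K i) = 2 \<and> K i \<subseteq> S) = (1 :: nat)" using KS by simp
        then show ?thesis using True two by linarith
      next
        case False
        then show ?thesis using True Ki(2) by linarith
      qed
    next
      case False
      moreover have "card (S \<inter> K i) \<le> card (K i)" using Ki(1) by (intro card_mono) auto
      ultimately have "card (S \<inter> K i) < card (K i)" by linarith
      then show ?thesis using Ki(2) by linarith
    qed
  qed
  have "card S \<le> (\<Sum>i\<in>I. card (S \<inter> K i))"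
    using card_UN_le[OF assms(1), of "\<lambda>i. S \<inter> K i"] unfolding S[symmetric] .
  also have "\<dots> \<le> (\<Sum>i\<in>I. 1 + of_bool (card (K i) = 2 \<and> K i \<subseteq> S))"
    using le by (rule sum_mono)
  also have "\<dots> = card I + card ?D"
    using assms(1) by (subst sum.distrib) (simp add: sum_of_bool_eq Int_def)
  finally show ?thesis .
qed

lemma card_less_index_plus_full:
  assumes "finite I" "\<And>i. i \<in> I \<Longrightarrow> finite (K i) \<and> card (K i) \<le> 2" "S \<subseteq> \<Union>(K ` I)"
    and "s \<in> I" "S \<inter> K s = {}"
  shows "card S < card I + card {i\<in>I. card (K i) = 2 \<and> K i \<subseteq> S}"
proof -
  have "card S \<le> card (I - {s}) + card {i\<in>I - {s}. card (K i) = 2 \<and> K i \<subseteq> S}"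
    using assms by (intro card_le_index_plus_full) blast+
  also have "\<dots> \<le> card (I - {s}) + card {i\<in>I. card (K i) = 2 \<and> K i \<subseteq> S}"
    using assms(1) by (intro add_left_mono card_mono) auto
  also have "card (I - {s}) < card I" using assms(1,4) by (rule card_Diff1_less)
  finally show ?thesis by simp
qed

text \<open>\<open>H\<close> indexes the split parts, \<open>R i\<close> is the merged class and
  \<open>Z i\<close> the class keeping a full list. The exceptional index \<open>a\<close> stands
  for a part of size four, where only one common color is guaranteed. One is enough: a surplus or a
  set of merged classes that involves \<open>a\<close> alone asks for a single color.\<close>

lemma hall_few_colors:
  assumes I: "finite I" "card I \<le> k" "H \<subseteq> I"
    and small: "\<And>i. i \<in> I - H \<Longrightarrow> finite (K i) \<and> card (K i) \<le> 1"
      "\<And>i q. i \<in> I - H \<Longrightarrow> q \<in> K i \<Longrightarrow> k \<le> card (A q)"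
    and big: "\<And>i. i \<in> H \<Longrightarrow> K i = {R i, Z i}" "\<And>i. i \<in> H \<Longrightarrow> k \<le> card (A (Z i))"
      "\<And>i. i \<in> H \<Longrightarrow> A (R i) \<inter> A (Z i) = {}" "\<And>i. i \<in> H \<Longrightarrow> A (R i) \<noteq> {}"
      "\<And>i. i \<in> H - {a} \<Longrightarrow> card H \<le> card (A (R i))"
    and fin: "\<And>q. q \<in> \<Union>(K ` I) \<Longrightarrow> finite (A q)"
    and S: "S \<subseteq> \<Union>(K ` I)"
  shows "card S \<le> card (\<Union>(A ` S))"
proof -
  let ?N = "\<Union>(A ` S)" and ?D = "{i\<in>I. card (K i) = 2 \<and> K i \<subseteq> S}"
  have finH: "finite H" using I by (meson finite_subset)
  have K: "finite (K i) \<and> card (K i) \<le> 2" if "i \<in> I" for i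
    using small(1)[of i] big(1)[of i] that by (cases "i \<in> H") (auto simp: card_insert_if)
  have cS: "card S \<le> k + card ?D"
    using card_le_index_plus_full[OF I(1) K S] I(2) by simp
  have "finite S" using S I(1) K by (meson finite_UN_I finite_subset)
  moreover have "finite (A q)" if "q \<in> S" for q using fin S that by blast
  ultimately have finN: "finite ?N" by auto
  have N: "card (A q) \<le> card ?N" if "q \<in> S" for q
    using finN that by (intro card_mono) auto
  have DH: "?D \<subseteq> H"
  proof
    fix i assume "i \<in> ?D"
    then show "i \<in> H" using small(1)[of i] by (cases "i \<in> H") auto
  qed
  have ND: "k + card (A (R i)) \<le> card ?N" if "i \<in> ?D" for i
  proof -
    have i: "i \<in> H" "R i \<in> S" "Z i \<in> S" using that DH big(1) by auto
    then have "A (R i) \<union> A (Z i) \<subseteq> ?N" by blast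
    then have "card (A (R i) \<union> A (Z i)) \<le> card ?N" using finN by (rule card_mono[rotated])
    moreover have "card (A (R i) \<union> A (Z i)) = card (A (R i)) + card (A (Z i))"
      using big(3) i \<open>\<And>q. q \<in> S \<Longrightarrow> finite (A q)\<close> by (intro card_Un_disjoint) auto
    ultimately show ?thesis using big(2)[OF i(1)] by simp
  qed
  show ?thesis
  proof (cases "?D = {}")
    case True
    then have cS: "card S \<le> k" using cS by (metis add.right_neutral card.empty)
    show ?thesis
    proof (cases "\<exists>q\<in>S. k \<le> card (A q)")
      case True
      then obtain q where "q \<in> S" "k \<le> card (A q)" by blast
      then show ?thesis using N[of q] cS by linarith
    next
      \<comment> \<open>Without a class having \<open>k\<close> colors, \<open>S\<close> consists of
        merged classes only, so it has at most \<open>card H\<close> elements.\<close>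
      case noFull: False
      have SR: "S \<subseteq> R ` H"
      proof
        fix q assume q: "q \<in> S"
        then obtain i where i: "i \<in> I" "q \<in> K i" using S by blast
        then have iH: "i \<in> H" using small(2)[of i q] noFull q by blast
        then have "q \<noteq> Z i" using big(2) noFull q by blast
        then show "q \<in> R ` H" using big(1)[OF iH] i(2) iH by blast
      qed
      show ?thesis
      proof (cases "S \<subseteq> {R a}")
        case True
        have "card S \<le> 1" using card_mono[OF _ True] by simp
        moreover have "1 \<le> card ?N" if nonempty: "S \<noteq> {}"
        proof -
          obtain q where q: "q \<in> S" using nonempty by blast
          then have "A q \<noteq> {}" using SR big(4) by auto
          then have "?N \<noteq> {}" using q by blast
          then show ?thesis using finN by (simp add: Suc_le_eq card_gt_0_iff)
        qed
        ultimately show ?thesis by (cases "S = {}") auto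
      next
        case False
        then obtain i where i: "i \<in> H - {a}" "R i \<in> S" using SR by blast
        have "card S \<le> card H" using SR finH by (meson card_image_le card_mono finite_imageI le_trans)
        then show ?thesis using big(5)[OF i(1)] N[OF i(2)] by simp
      qed
    qed
  next
    case D: False
    show ?thesis
    \<comment> \<open>The surplus is \<open>card ?D\<close>. It is 1 if only \<open>a\<close> causes
      it; otherwise the merged class of some \<open>i \<noteq> a\<close> in \<open>?D\<close> pays
      for all of it.\<close>
    proof (cases "?D \<subseteq> {a}")
      case True
      then have "card ?D \<le> 1" using card_mono[OF _ True] by simp
      moreover obtain i where i: "i \<in> ?D" using D by blast
      moreover have "1 \<le> card (A (R i))"
      proof -
        have "R i \<in> S" "i \<in> H" using i DH big(1) by auto
        then show ?thesis using big(4) \<open>\<And>q. q \<in> S \<Longrightarrow> finite (A q)\<close>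
          by (metis One_nat_def Suc_leI card_gt_0_iff)
      qed
      ultimately show ?thesis using ND[of i] cS by linarith
    next
      case False
      then obtain i where i: "i \<in> ?D" "i \<noteq> a" by blast
      then have "card H \<le> card (A (R i))" using big(5) DH by blast
      moreover have "card ?D \<le> card H" using DH finH by (rule card_mono[rotated])
      ultimately show ?thesis using ND[OF i(1)] cS by linarith
    qed
  qed
qed

text \<open>The set \<open>K a\<close> holds the two classes of the part of size four, which may both be merged. In that case
  the count of \<open>k + 1\<close> colors is only reached with the help of a part consisting of a single vertex.\<close>

lemma hall_many_colors:
  assumes I: "finite I" "card I \<le> k" "{a, b, c, s} \<subseteq> I" "s \<notin> {a, b, c}"
    and rest: "\<And>i. i \<in> I - {a, b, c} \<Longrightarrow> finite (K i) \<and> card (K i) \<le> 2"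
      "\<And>i. i \<in> I - {a, b, c} \<Longrightarrow> card (K i) = 2 \<Longrightarrow> card (\<Union>(K ` I)) \<le> card (\<Union>(A ` K i))"
      "\<And>i q. i \<in> I - {a, b, c} \<Longrightarrow> q \<in> K i \<Longrightarrow> k \<le> card (A q)"
    and Ks: "K s = {t}"
    and Ka: "K a = {ra, za}" "A ra \<noteq> {}" "A za \<noteq> {}" "4 \<le> card (A ra \<union> A za)"
      "k + 1 \<le> card (A ra \<union> A za \<union> A t)"
    and Kb: "K b = {rb, zb}" "2 \<le> card (A rb)" "k \<le> card (A zb)" "A rb \<inter> A zb = {}"
    and Kc: "K c = {rc, zc}" "2 \<le> card (A rc)" "k \<le> card (A zc)" "A rc \<inter> A zc = {}"
    and bc: "3 \<le> card (A rb \<union> A rc)" "k + 3 \<le> card (A rb \<union> A zb \<union> (A rc \<union> A zc))"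
    and fin: "\<And>q. q \<in> \<Union>(K ` I) \<Longrightarrow> finite (A q)"
    and S: "S \<subseteq> \<Union>(K ` I)"
  shows "card S \<le> card (\<Union>(A ` S))"
proof -
  let ?N = "\<Union>(A ` S)" and ?D = "{i\<in>I. card (K i) = 2 \<and> K i \<subseteq> S}"
  have K: "finite (K i) \<and> card (K i) \<le> 2" if "i \<in> I" for i
    using rest(1)[of i] Ka(1) Kb(1) Kc(1) that
    by (cases "i \<in> {a, b, c}") (auto simp: card_insert_if)
  have finJ: "finite (\<Union>(K ` I))" using I(1) K by blast
  then have finS: "finite S" using S by (rule finite_subset[rotated])
  have finA: "finite (A q)" if "q \<in> S" for q using fin S that by blast
  then have finN: "finite ?N" using finS by auto
  have N: "card B \<le> card ?N" if "B \<subseteq> ?N" for B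
    using finN that by (rule card_mono)
  have Nq: "card (A q) \<le> card ?N" if "q \<in> S" for q
    using that by (intro N) auto
  \<comment> \<open>If both vertices of a part of size two belong to \<open>S\<close>, their lists
    already provide enough colors for all classes together.\<close>
  show ?thesis
  proof (cases "\<exists>i\<in>I - {a, b, c}. card (K i) = 2 \<and> K i \<subseteq> S")
    case True
    then obtain i where i: "i \<in> I - {a, b, c}" "card (K i) = 2" "K i \<subseteq> S" by blast
    have "card S \<le> card (\<Union>(K ` I))" using S finJ by (rule card_mono[rotated])
    also have "\<dots> \<le> card (\<Union>(A ` K i))" using rest(2) i by blast
    also have "\<dots> \<le> card ?N" using i(3) by (intro N) blast
    finally show ?thesis .
  next
    case False
    then have D: "?D \<subseteq> {a, b, c}" by blast
    have cS: "card S \<le> k + card ?D"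
      using card_le_index_plus_full[OF I(1) K S] I(2) by simp
    have cS': "card S \<le> k + card B" if "?D \<subseteq> B" "finite B" for B
      using cS card_mono[OF that(2,1)] by linarith
    have c3: "card {a, b, c} \<le> 3" "card {a, b} \<le> 2" "card {a, c} \<le> 2"
      by (simp_all add: card_insert_if)
    \<comment> \<open>The surplus is at most 3, and at most 2 unless \<open>b\<close> and
      \<open>c\<close> both contribute two classes. One of them alone provides \<open>k + 2\<close>
      colors, both together \<open>k + 3\<close>.\<close>
    show ?thesis
    proof (cases "b \<in> ?D \<or> c \<in> ?D")
      case True
      then consider "b \<in> ?D" "c \<in> ?D" | "b \<in> ?D" "c \<notin> ?D" | "b \<notin> ?D" "c \<in> ?D" by blast
      then show ?thesis
      proof cases
        case 1
        then have "A rb \<union> A zb \<union> (A rc \<union> A zc) \<subseteq> ?N" using Kb(1) Kc(1) by auto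
        from N[OF this] show ?thesis using bc(2) cS'[OF D] c3 by simp
      next
        case 2
        then have "rb \<in> S" "zb \<in> S" using Kb(1) by auto
        then have "card (A rb \<union> A zb) \<le> card ?N" "card (A rb \<union> A zb) = card (A rb) + card (A zb)"
          using Kb(4) finA by (auto intro!: N card_Un_disjoint)
        moreover have "?D \<subseteq> {a, b}" using D 2 by auto
        ultimately show ?thesis using Kb(2,3) cS'[of "{a, b}"] c3 by simp
      next
        case 3
        then have "rc \<in> S" "zc \<in> S" using Kc(1) by auto
        then have "card (A rc \<union> A zc) \<le> card ?N" "card (A rc \<union> A zc) = card (A rc) + card (A zc)"
          using Kc(4) finA by (auto intro!: N card_Un_disjoint)
        moreover have "?D \<subseteq> {a, c}" using D 3 by auto
        ultimately show ?thesis using Kc(2,3) cS'[of "{a, c}"] c3 by simp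
      qed
    next
      case nbc: False
      then have Da: "?D \<subseteq> {a}" using D by blast
      show ?thesis
      \<comment> \<open>The only possible surplus is now the one from \<open>a\<close>. If
        \<open>t\<close> is in \<open>S\<close>, the three color sets make \<open>k + 1\<close>. If
        not, \<open>S\<close> misses the part \<open>s\<close> altogether, which cancels the
        surplus.\<close>
      proof (cases "a \<in> ?D \<and> t \<in> S")
        case True
        then have "A ra \<union> A za \<union> A t \<subseteq> ?N" using Ka(1) by auto
        from N[OF this] show ?thesis using Ka(5) cS'[OF Da] by simp
      next
        case False
        have cSk: "card S \<le> k"
        proof (cases "a \<in> ?D")
          case True
          then have "S \<inter> K s = {}" using False Ks by auto
          then have "card S < card I + card ?D"
            using I K S by (intro card_less_index_plus_full[of I K S s]) auto
          moreover have "card ?D \<le> 1" using card_mono[OF _ Da] by simp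
          ultimately show ?thesis using I(2) by linarith
        next
          case False
          then have "?D \<subseteq> {}" using Da by blast
          then show ?thesis using cS'[of "{}"] by simp
        qed
        show ?thesis
        proof (cases "\<exists>q\<in>S. k \<le> card (A q)")
          case True
          then obtain q where "q \<in> S" "k \<le> card (A q)" by blast
          then show ?thesis using Nq[of q] cSk by linarith
        next
          case noFull: False
          \<comment> \<open>Only these four classes can have fewer than \<open>k\<close> colors;
            sets of 4, 3, 2 and 1 of them are treated in turn.\<close>
          have SR: "S \<subseteq> {ra, za, rb, rc}"
          proof
            fix q assume q: "q \<in> S"
            then obtain i where i: "i \<in> I" "q \<in> K i" using S by blast
            then have "i \<in> {a, b, c}" using rest(3)[of i q] noFull q by blast
            then show "q \<in> {ra, za, rb, rc}"
              using i Ka(1) Kb(1,3) Kc(1,3) noFull q by auto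
          qed
          have card4: "card {p, q, r, s} \<le> 4" "card {p, q, r} \<le> 3" "card {p, q} \<le> 2" for p q r s :: 'b
            by (simp_all add: card_insert_if)
          show ?thesis
          proof (cases "ra \<in> S \<and> za \<in> S")
            case True
            then have "card (A ra \<union> A za) \<le> card ?N" by (intro N) auto
            then show ?thesis using card_mono[OF _ SR] card4(1)[of ra za rb rc] Ka(4) by simp
          next
            case False
            then obtain w where w: "S \<subseteq> {w, rb, rc}" "w \<in> {ra, za}" using SR by blast
            show ?thesis
            proof (cases "rb \<in> S \<and> rc \<in> S")
              case True
              then have "card (A rb \<union> A rc) \<le> card ?N" by (intro N) auto
              then show ?thesis using card_mono[OF _ w(1)] card4(2)[of w rb rc] bc(1) by simp
            next
              case False
              then obtain w' where w': "S \<subseteq> {w, w'}" "w' \<in> {rb, rc}" using w by blast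
              show ?thesis
              proof (cases "w' \<in> S")
                case True
                then have "2 \<le> card ?N" using Nq[OF True] w'(2) Kb(2) Kc(2) by auto
                then show ?thesis using card_mono[OF _ w'(1)] card4(3)[of w w'] by simp
              next
                case False
                then have Sw: "S \<subseteq> {w}" using w' by blast
                then have "card S \<le> 1" using card_mono[OF _ Sw] by simp
                moreover have "1 \<le> card ?N" if nonempty: "S \<noteq> {}"
                proof -
                  have "?N \<noteq> {}" using Sw w(2) Ka(2,3) nonempty by auto
                  then show ?thesis using finN by (simp add: Suc_le_eq card_gt_0_iff)
                qed
                ultimately show ?thesis by (cases "S = {}") auto
              qed
            qed
          qed
        qed
      qed
    qed
  qed
qed

section \<open>Merging the parts of size three and four\<close>

lemma card_Un3:
  assumes "finite A" "finite B" "finite C" "A \<inter> B \<inter> C = {}"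
  shows "card (A \<union> B \<union> C) + (card (A \<inter> B) + card (A \<inter> C) + card (B \<inter> C)) = card A + card B + card C"
proof -
  have "card A + card B = card (A \<union> B) + card (A \<inter> B)"
    using assms by (intro card_Un_Int)
  moreover have "card (A \<union> B) + card C = card (A \<union> B \<union> C) + card ((A \<union> B) \<inter> C)"
    using assms by (intro card_Un_Int) auto
  moreover have "(A \<union> B) \<inter> C = (A \<inter> C) \<union> (B \<inter> C)" by blast
  moreover have "card ((A \<inter> C) \<union> (B \<inter> C)) = card (A \<inter> C) + card (B \<inter> C)"
    using assms by (intro card_Un_disjoint) auto
  ultimately show ?thesis by simp
qed

text \<open>Inclusion-exclusion without a triple term. The pairs are indexed by the omitted vertex,
  so that a large summand at \<open>z\<close> tells which vertex to leave alone when the other two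
  are merged.\<close>

lemma card_3_part:
  assumes p: "card p = 3" and L: "\<forall>v\<in>p. finite (L v) \<and> card (L v) = k" "\<Inter>(L ` p) = {}"
  shows "(\<Sum>z\<in>p. card (\<Inter>(L ` (p - {z})))) + card (\<Union>(L ` p)) = 3 * k"
proof -
  obtain x y z where xyz: "p = {x, y, z}" "x \<noteq> y" "x \<noteq> z" "y \<noteq> z" using p by (metis card_3_iff)
  have "p - {x} = {y, z}" "p - {y} = {x, z}" "p - {z} = {x, y}" using xyz by auto
  then have "(\<Sum>z\<in>p. card (\<Inter>(L ` (p - {z})))) =
      card (L y \<inter> L z) + card (L x \<inter> L z) + card (L x \<inter> L y)"
    using xyz by (simp add: Int_commute)
  moreover have "\<Union>(L ` p) = L x \<union> L y \<union> L z" "L x \<inter> L y \<inter> L z = {}" using xyz L(2) by auto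
  ultimately show ?thesis using card_Un3[of "L x" "L y" "L z"] L(1) xyz(1) by simp
qed

lemma Inter_part_disjoint:
  assumes "\<Inter>(L ` p) = {}" "z \<in> p"
  shows "\<Inter>(L ` (p - {z})) \<inter> L z = {}"
proof -
  have "p = insert z (p - {z})" using assms(2) by blast
  then have "\<Inter>(L ` p) = L z \<inter> \<Inter>(L ` (p - {z}))" by (metis INF_insert)
  then show ?thesis using assms(1) by blast
qed

lemma card_part_classes:
  assumes p: "\<forall>v\<in>p. finite (L v) \<and> card (L v) = k" "\<Inter>(L ` p) = {}" "z \<in> p" "p \<noteq> {z}"
  shows "card (\<Inter>(L ` (p - {z})) \<union> L z) = card (\<Inter>(L ` (p - {z}))) + k"
    "finite (\<Inter>(L ` (p - {z})))"
proof -
  obtain v where "v \<in> p - {z}" using p(3,4) by blast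
  then show "finite (\<Inter>(L ` (p - {z})))" using p(1) by (meson DiffD1 INT_lower finite_subset)
  then show "card (\<Inter>(L ` (p - {z})) \<union> L z) = card (\<Inter>(L ` (p - {z}))) + k"
    using p by (subst card_Un_disjoint[OF _ _ Inter_part_disjoint]) auto
qed

lemma eq_upper_bound_of_sum:
  fixes f :: "'b \<Rightarrow> nat"
  assumes "card p = n" "0 < n" "\<forall>y\<in>p. f y \<le> m" "n * m \<le> sum f p" "v \<in> p"
  shows "f v = m"
proof -
  have "finite p" using assms(1,2) card_ge_0_finite by blast
  have "n * m \<le> f v + sum f (p - {v})"
    using assms(4,5) sum.remove[OF \<open>finite p\<close>, of v f] by simp
  also have "sum f (p - {v}) \<le> card (p - {v}) * m"
    using assms(3) sum_bounded_above[of "p - {v}" f m] by simp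
  also have "card (p - {v}) = n - 1" using assms(1,5) \<open>finite p\<close> by simp
  finally have "n * m \<le> f v + (n - 1) * m" by simp
  then have "m \<le> f v" using assms(2) by (cases n) auto
  then show ?thesis using assms(3,5) by (simp add: le_antisym)
qed

lemma exists_large_pair_class:
  fixes m :: nat
  assumes p: "card p = 3" and L: "\<forall>v\<in>p. finite (L v) \<and> card (L v) = k" "\<Inter>(L ` p) = {}"
    and "card (\<Union>(L ` p)) + 3 * m < 3 * k + 3"
  shows "\<exists>z\<in>p. m \<le> card (\<Inter>(L ` (p - {z})))"
proof (rule ccontr)
  assume "\<not> ?thesis"
  then have lt: "card (\<Inter>(L ` (p - {z}))) < m" if "z \<in> p" for z using that by auto
  obtain z where "z \<in> p" using p by fastforce
  then have "0 < m" using lt by force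
  have "(\<Sum>z\<in>p. card (\<Inter>(L ` (p - {z})))) \<le> card p * (m - 1)"
    using sum_bounded_above[of p "\<lambda>z. card (\<Inter>(L ` (p - {z})))" "m - 1"] lt by fastforce
  then show False using card_3_part[OF p L] p assms(4) \<open>0 < m\<close> by simp
qed

text \<open>A single pair class with three colors gives both union bounds by itself, whatever is
  chosen in the other part. The remaining case is rigid: it forces \<open>k = 6\<close> and exactly
  two colors in every pair class of both parts.\<close>

lemma exists_good_pair_classes:
  assumes p: "card p = 3" "\<forall>v\<in>p. finite (L v) \<and> card (L v) = k" "\<Inter>(L ` p) = {}"
      "card (\<Union>(L ` p)) \<le> 2 * k"
    and q: "card q = 3" "\<forall>v\<in>q. finite (L v) \<and> card (L v) = k" "\<Inter>(L ` q) = {}"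
      "card (\<Union>(L ` q)) \<le> 2 * k"
    and k: "6 \<le> k"
  obtains y z where "y \<in> p" "z \<in> q" "2 \<le> card (\<Inter>(L ` (p - {y})))" "2 \<le> card (\<Inter>(L ` (q - {z})))"
    "3 \<le> card (\<Inter>(L ` (p - {y})) \<union> \<Inter>(L ` (q - {z})))"
    "k + 3 \<le> card (\<Inter>(L ` (p - {y})) \<union> L y \<union> (\<Inter>(L ` (q - {z})) \<union> L z))"
proof -
  let ?P = "\<lambda>z. \<Inter>(L ` (p - {z}))" and ?Q = "\<lambda>z. \<Inter>(L ` (q - {z}))"
  have ne: "p \<noteq> {z}" "q \<noteq> {z}" for z using p(1) q(1) by auto
  note P = card_part_classes[OF p(2,3) _ ne(1)] and Q = card_part_classes[OF q(2,3) _ ne(2)]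
  have fin: "finite (?P y \<union> L y \<union> (?Q z \<union> L z))" if "y \<in> p" "z \<in> q" for y z
    using P(2) Q(2) p(2) q(2) that by simp
  have big: "3 \<le> card (?P y \<union> ?Q z) \<and> k + 3 \<le> card (?P y \<union> L y \<union> (?Q z \<union> L z))"
    if "y \<in> p" "z \<in> q" "3 \<le> card (?P y) \<or> 3 \<le> card (?Q z)" for y z
  proof -
    have "card (?P y) \<le> card (?P y \<union> ?Q z)" "card (?Q z) \<le> card (?P y \<union> ?Q z)"
      "card (?P y \<union> L y) \<le> card (?P y \<union> L y \<union> (?Q z \<union> L z))"
      "card (?Q z \<union> L z) \<le> card (?P y \<union> L y \<union> (?Q z \<union> L z))"
      using fin[OF that(1,2)] by (auto intro!: card_mono)
    then show ?thesis using P(1)[OF that(1)] Q(1)[OF that(2)] that(3) by linarith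
  qed
  obtain y0 where y0: "y0 \<in> p" "2 \<le> card (?P y0)"
    using exists_large_pair_class[OF p(1-3), of 2] p(4) k by auto
  obtain z0 where z0: "z0 \<in> q" "2 \<le> card (?Q z0)"
    using exists_large_pair_class[OF q(1-3), of 2] q(4) k by auto
  show ?thesis
  proof (cases "(\<exists>y\<in>p. 3 \<le> card (?P y)) \<or> (\<exists>z\<in>q. 3 \<le> card (?Q z))")
    case True
    then show ?thesis
    proof
      assume "\<exists>y\<in>p. 3 \<le> card (?P y)"
      then obtain y where "y \<in> p" "3 \<le> card (?P y)" by blast
      then show ?thesis using that[of y z0] z0 big[of y z0] by simp
    next
      assume "\<exists>z\<in>q. 3 \<le> card (?Q z)"
      then obtain z where "z \<in> q" "3 \<le> card (?Q z)" by blast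
      then show ?thesis using that[of y0 z] y0 big[of y0 z] by simp
    qed
  next
    case False
    then have leP: "\<forall>y\<in>p. card (?P y) \<le> 2" and leQ: "\<forall>z\<in>q. card (?Q z) \<le> 2"
      by fastforce+
    have sumP: "k \<le> (\<Sum>y\<in>p. card (?P y))" and sumQ: "k \<le> (\<Sum>z\<in>q. card (?Q z))"
      using card_3_part[OF p(1-3)] card_3_part[OF q(1-3)] p(4) q(4) by linarith+
    obtain y1 y2 y3 where y: "p = {y1, y2, y3}" "y1 \<noteq> y2" "y1 \<noteq> y3" "y2 \<noteq> y3"
      using p(1) by (metis card_3_iff)
    \<comment> \<open>Three numbers that are at most 2 and sum to at least \<open>k \<ge> 6\<close>
      all equal 2, and then \<open>k\<close> is 6.\<close>
    have P2: "card (?P v) = 2" if "v \<in> p" for v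
      using eq_upper_bound_of_sum[of p 3 "\<lambda>y. card (?P y)" 2 v] that leP sumP k p(1) by simp
    have Q2: "card (?Q v) = 2" if "v \<in> q" for v
      using eq_upper_bound_of_sum[of q 3 "\<lambda>y. card (?Q y)" 2 v] that leQ sumQ k q(1) by simp
    have k6: "k = 6" using sumP P2 p(1) k by simp
    define T where "T = (\<Union>y\<in>p. ?P y)"
    have disjP: "?P y \<inter> ?P y' = {}" if "y \<in> p" "y' \<in> p" "y \<noteq> y'" for y y'
    proof -
      have "p = (p - {y}) \<union> (p - {y'})" using that by blast
      then have "?P y \<inter> ?P y' = \<Inter>(L ` p)" by (metis INF_union)
      then show ?thesis using p(3) by simp
    qed
    have "finite p" using y(1) by simp
    then have "finite T" unfolding T_def using P(2) by blast
    have "card T = (\<Sum>y\<in>p. card (?P y))" unfolding T_def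
      using P(2) disjP \<open>finite p\<close> by (intro card_UN_disjoint) auto
    then have T6: "card T = 6" using P2 p(1) by simp
    \<comment> \<open>\<open>T\<close> has exactly \<open>k\<close> elements, so lists inside
      \<open>T\<close> would all equal \<open>T\<close> and share their colors. A color
      \<open>c\<close> outside \<open>T\<close> lies in at most one list of \<open>p\<close>, which
      leaves two vertices of \<open>p\<close> whose lists avoid it.\<close>
    have "\<exists>z\<in>q. \<not> L z \<subseteq> T"
    proof (rule ccontr)
      assume "\<not> ?thesis"
      then have "L z = T" if "z \<in> q" for z
        using q(2)[rule_format, OF that] that \<open>finite T\<close> T6 k6 by (intro card_subset_eq) auto
      then have "T \<subseteq> \<Inter>(L ` q)" by blast
      then show False using q(3) T6 by auto
    qed
    then obtain z c where zc: "z \<in> q" "c \<in> L z" "c \<notin> T" by blast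
    have cP: "c \<notin> ?P y" if "y \<in> p" for y using zc(3) that unfolding T_def by blast
    have one: "c \<notin> L u \<or> c \<notin> L v" if "u \<in> p" "v \<in> p" "u \<noteq> v" for u v
    proof -
      have "card (p - {u, v}) = 1" using that p(1) \<open>finite p\<close> by (simp add: card_Diff_subset)
      then obtain w where "p - {u, v} = {w}" by (rule card_1_singletonE)
      then have "w \<in> p" "p - {w} = {u, v}" using that by blast+
      then show ?thesis using cP[of w] by auto
    qed
    obtain u v where uv: "u \<in> p" "v \<in> p" "u \<noteq> v" "c \<notin> L u" "c \<notin> L v"
      using one[of y1 y2] one[of y1 y3] one[of y2 y3] y by auto
    \<comment> \<open>Two different pair classes cannot both equal \<open>?Q z\<close>. The chosen
      \<open>x\<close> therefore gains a color from \<open>?Q z\<close> in the first union and the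
      color \<open>c\<close> in the second.\<close>
    have "?P u \<noteq> ?P v" using disjP[OF uv(1-3)] P2[OF uv(1)] by auto
    then obtain x where x: "x \<in> p" "c \<notin> L x" "?P x \<noteq> ?Q z" using uv by metis
    have "card (?P x \<union> ?Q z) \<noteq> 2"
    proof
      assume eq2: "card (?P x \<union> ?Q z) = 2"
      have fx: "finite (?P x \<union> ?Q z)" using fin[OF x(1) zc(1)] by simp
      have "?P x = ?P x \<union> ?Q z" using eq2 P2[OF x(1)] fx by (intro card_subset_eq) auto
      moreover have "?Q z = ?P x \<union> ?Q z" using eq2 Q2[OF zc(1)] fx by (intro card_subset_eq) auto
      ultimately show False using x(3) by simp
    qed
    moreover have "card (?P x) \<le> card (?P x \<union> ?Q z)"
      using fin[OF x(1) zc(1)] by (intro card_mono) auto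
    ultimately have 3: "3 \<le> card (?P x \<union> ?Q z)" using P2[OF x(1)] by linarith
    have "insert c (?P x \<union> L x) \<subseteq> ?P x \<union> L x \<union> (?Q z \<union> L z)" using zc by blast
    then have "card (insert c (?P x \<union> L x)) \<le> card (?P x \<union> L x \<union> (?Q z \<union> L z))"
      using fin[OF x(1) zc(1)] by (rule card_mono[rotated])
    moreover have "card (insert c (?P x \<union> L x)) = Suc (card (?P x \<union> L x))"
      using cP[OF x(1)] x(2) P(2)[OF x(1)] p(2)[rule_format, OF x(1)] by (intro card_insert_disjoint) auto
    ultimately have "k + 3 \<le> card (?P x \<union> L x \<union> (?Q z \<union> L z))"
      using P(1)[OF x(1)] P2[OF x(1)] by linarith
    then show ?thesis using that[of x z] x(1) zc(1) P2 Q2 3 by simp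
  qed
qed

section \<open>Splitting a part of size four\<close>

lemma card_4_distinct:
  assumes "card p = 4"
  obtains w x y z where "p = {w, x, y, z}" "distinct [w, x, y, z]"
proof -
  obtain w where "w \<in> p" using assms by fastforce
  moreover have "finite p" using assms card_ge_0_finite by force
  ultimately have "card (p - {w}) = 3" using assms by simp
  then obtain x y z where "p - {w} = {x, y, z}" "x \<noteq> y" "x \<noteq> z" "y \<noteq> z" by (metis card_3_iff)
  then show thesis using that[of w x y z] \<open>w \<in> p\<close> by (auto simp: set_eq_iff)
qed

text \<open>Every color lies in at most two of the four lists, so \<open>4 * k\<close> incidences
  need \<open>2 * k\<close> colors. In case of equality the pair intersections at each vertex sum to
  exactly \<open>k\<close>; adding the equations of two vertices and subtracting the other two shows
  that opposite pairs have equally many common colors.\<close>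

lemma four_part_no_triple:
  assumes p: "p = {w, x, y, z}" "distinct [w, x, y, z]"
    and L: "\<forall>v\<in>p. finite (L v) \<and> card (L v) = k"
    and triple: "\<forall>v\<in>p. \<Inter>(L ` (p - {v})) = {}"
  shows "2 * k \<le> card (\<Union>(L ` p))"
    and "card (\<Union>(L ` p)) \<le> 2 * k \<Longrightarrow>
      card (L w \<inter> L x) + card (L w \<inter> L y) + card (L w \<inter> L z) = k \<and>
      card (L w \<inter> L x) = card (L y \<inter> L z) \<and> card (L w \<inter> L y) = card (L x \<inter> L z) \<and>
      card (L w \<inter> L z) = card (L x \<inter> L y)"
proof -
  have tr: "L x \<inter> L y \<inter> L z = {}" "L w \<inter> L y \<inter> L z = {}" "L w \<inter> L x \<inter> L z = {}" "L w \<inter> L x \<inter> L y = {}"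
    using triple p by auto
  have f: "finite (L w)" "finite (L x)" "finite (L y)" "finite (L z)"
    and c: "card (L w) = k" "card (L x) = k" "card (L y) = k" "card (L z) = k"
    using L p(1) by auto
  have le: "card (A \<inter> B) + card (A \<inter> C) + card (A \<inter> D) = card (A \<inter> (B \<union> C \<union> D))"
    if "finite A" "A \<inter> B \<inter> C = {}" "A \<inter> B \<inter> D = {}" "A \<inter> C \<inter> D = {}" for A B C D :: "'b set"
  proof -
    have "A \<inter> (B \<union> C \<union> D) = (A \<inter> B \<union> A \<inter> C) \<union> A \<inter> D" by blast
    also have "card \<dots> = card (A \<inter> B \<union> A \<inter> C) + card (A \<inter> D)"
      using that by (intro card_Un_disjoint) auto
    also have "card (A \<inter> B \<union> A \<inter> C) = card (A \<inter> B) + card (A \<inter> C)"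
      using that by (intro card_Un_disjoint) auto
    finally show ?thesis by simp
  qed
  have le': "card (A \<inter> B) + card (A \<inter> C) + card (A \<inter> D) \<le> card A"
    if "finite A" "A \<inter> B \<inter> C = {}" "A \<inter> B \<inter> D = {}" "A \<inter> C \<inter> D = {}" for A B C D :: "'b set"
    unfolding le[OF that] using that(1) by (intro card_mono) auto
  have "card (L w) + card (L x \<union> L y \<union> L z) =
      card (L w \<union> (L x \<union> L y \<union> L z)) + card (L w \<inter> (L x \<union> L y \<union> L z))"
    using f by (intro card_Un_Int) auto
  moreover have "L w \<union> (L x \<union> L y \<union> L z) = \<Union>(L ` p)" using p(1) by auto
  moreover note card_Un3[OF f(2-4) tr(1)]
  moreover have "card (L w \<inter> L x) + card (L w \<inter> L y) + card (L w \<inter> L z) = card (L w \<inter> (L x \<union> L y \<union> L z))"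
    using tr by (intro le[OF f(1)]) auto
  moreover have "card (L w \<inter> L x) + card (L w \<inter> L y) + card (L w \<inter> L z) \<le> card (L w)"
    using tr by (intro le'[OF f(1)]) auto
  moreover have "card (L x \<inter> L w) + card (L x \<inter> L y) + card (L x \<inter> L z) \<le> card (L x)"
    using tr by (intro le'[OF f(2)]) auto
  moreover have "card (L y \<inter> L w) + card (L y \<inter> L x) + card (L y \<inter> L z) \<le> card (L y)"
    using tr by (intro le'[OF f(3)]) auto
  moreover have "card (L z \<inter> L w) + card (L z \<inter> L x) + card (L z \<inter> L y) \<le> card (L z)"
    using tr by (intro le'[OF f(4)]) auto
  moreover have "L x \<inter> L w = L w \<inter> L x" "L y \<inter> L w = L w \<inter> L y" "L z \<inter> L w = L w \<inter> L z"
    "L y \<inter> L x = L x \<inter> L y" "L z \<inter> L x = L x \<inter> L z" "L z \<inter> L y = L y \<inter> L z" by auto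
  ultimately have *: "card (\<Union>(L ` p)) + (card (L x \<inter> L y) + card (L x \<inter> L z) + card (L y \<inter> L z))
        + (card (L w \<inter> L x) + card (L w \<inter> L y) + card (L w \<inter> L z)) = 4 * k"
    "card (L w \<inter> L x) + card (L w \<inter> L y) + card (L w \<inter> L z) \<le> k"
    "card (L w \<inter> L x) + card (L x \<inter> L y) + card (L x \<inter> L z) \<le> k"
    "card (L w \<inter> L y) + card (L x \<inter> L y) + card (L y \<inter> L z) \<le> k"
    "card (L w \<inter> L z) + card (L x \<inter> L z) + card (L y \<inter> L z) \<le> k"
    using c by simp_all
  show "2 * k \<le> card (\<Union>(L ` p))" using * by linarith
  show "card (L w \<inter> L x) + card (L w \<inter> L y) + card (L w \<inter> L z) = k \<and>
      card (L w \<inter> L x) = card (L y \<inter> L z) \<and> card (L w \<inter> L y) = card (L x \<inter> L z) \<and>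
      card (L w \<inter> L z) = card (L x \<inter> L y)" if "card (\<Union>(L ` p)) \<le> 2 * k"
    using * that by linarith
qed

text \<open>Here \<open>a\<close>, \<open>b\<close>, \<open>c\<close> are the pair sizes of the
  three pairings of a part of size four, and \<open>A\<close>, \<open>B\<close>, \<open>C\<close>
  say that the colors of a pairing all lie in a given list of size \<open>k\<close>. If every
  pairing failed, each number without its flag would be at most 1. Three flags would give
  \<open>4 * k \<le> 3 * k\<close>; with fewer flags, the flagged numbers have sum at most half of
  \<open>k\<close>, too little for \<open>k \<ge> 6\<close>.\<close>

lemma two_le_unless_small_sums:
  fixes a b c k :: nat
  assumes "a + b + c = k" "6 \<le> k" "A \<Longrightarrow> 2 * a \<le> k" "B \<Longrightarrow> 2 * b \<le> k" "C \<Longrightarrow> 2 * c \<le> k"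
    "A \<Longrightarrow> B \<Longrightarrow> 2 * (a + b) \<le> k" "A \<Longrightarrow> C \<Longrightarrow> 2 * (a + c) \<le> k" "B \<Longrightarrow> C \<Longrightarrow> 2 * (b + c) \<le> k"
  shows "2 \<le> a \<and> \<not> A \<or> 2 \<le> b \<and> \<not> B \<or> 2 \<le> c \<and> \<not> C"
proof (rule ccontr)
  assume "\<not> ?thesis"
  then have "A \<or> a \<le> 1" "B \<or> b \<le> 1" "C \<or> c \<le> 1" by linarith+
  then have "2 * a \<le> k \<or> a \<le> 1" "2 * b \<le> k \<or> b \<le> 1" "2 * c \<le> k \<or> c \<le> 1"
    "2 * (a + b) \<le> k \<or> a \<le> 1 \<or> b \<le> 1" "2 * (a + c) \<le> k \<or> a \<le> 1 \<or> c \<le> 1"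
    "2 * (b + c) \<le> k \<or> b \<le> 1 \<or> c \<le> 1"
    using assms(3-8) by blast+
  then show False using assms(1,2) by presburger
qed

text \<open>\<open>D\<close> will be the list of a vertex forming a part by itself. A triple with a
  common color gives \<open>k + 1\<close> colors without help from \<open>D\<close>. Otherwise the
  color sets of the three pairings are disjoint and have \<open>2 * k\<close> elements in total,
  while \<open>D\<close> can contain only \<open>k\<close> of them; so some pairing with two colors
  per pair is not inside \<open>D\<close>.\<close>

lemma exists_split_4_part:
  assumes p: "card p = 4" "\<forall>v\<in>p. finite (L v) \<and> card (L v) = k" "\<Inter>(L ` p) = {}"
      "card (\<Union>(L ` p)) \<le> 2 * k"
    and D: "finite D" "card D = k" and k: "6 \<le> k"
  obtains r q where "r \<union> q = p" "r \<noteq> {}" "q \<noteq> {}" "\<Inter>(L ` r) \<noteq> {}" "\<Inter>(L ` q) \<noteq> {}"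
    "4 \<le> card (\<Inter>(L ` r) \<union> \<Inter>(L ` q))" "k + 1 \<le> card (\<Inter>(L ` r) \<union> \<Inter>(L ` q) \<union> D)"
proof (cases "\<exists>v\<in>p. \<Inter>(L ` (p - {v})) \<noteq> {}")
  case True
  then obtain v where v: "v \<in> p" "\<Inter>(L ` (p - {v})) \<noteq> {}" by blast
  have "p \<noteq> {v}" using p(1) by auto
  note c = card_part_classes[OF p(2,3) v(1) this]
  then have "k + 1 \<le> card (\<Inter>(L ` (p - {v})) \<union> L v)"
    using v(2) by (simp add: Suc_le_eq card_gt_0_iff)
  moreover have "card (\<Inter>(L ` (p - {v})) \<union> L v) \<le> card (\<Inter>(L ` (p - {v})) \<union> L v \<union> D)"
    using c(2) p(2)[rule_format, OF v(1)] D(1) by (intro card_mono) auto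
  moreover have "L v \<noteq> {}" using p(2)[rule_format, OF v(1)] k by auto
  ultimately show ?thesis using that[of "p - {v}" "{v}"] v \<open>p \<noteq> {v}\<close> k by (auto simp: insert_absorb)
next
  case False
  note split = that
  obtain w x y z where wxyz: "p = {w, x, y, z}" "distinct [w, x, y, z]"
    using card_4_distinct[OF p(1)] .
  note four = four_part_no_triple(2)[OF wxyz p(2) _ p(4)]
  have tr: "L x \<inter> L y \<inter> L z = {}" "L w \<inter> L y \<inter> L z = {}" "L w \<inter> L x \<inter> L z = {}" "L w \<inter> L x \<inter> L y = {}"
    using False wxyz by auto
  have f: "finite (L w)" "finite (L x)" "finite (L y)" "finite (L z)" using p(2) wxyz by auto
  let ?Q1 = "L w \<inter> L x \<union> L y \<inter> L z" and ?Q2 = "L w \<inter> L y \<union> L x \<inter> L z" and ?Q3 = "L w \<inter> L z \<union> L x \<inter> L y"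
  have Q: "card ?Q1 = 2 * card (L w \<inter> L x)" "card ?Q2 = 2 * card (L w \<inter> L y)" "card ?Q3 = 2 * card (L w \<inter> L z)"
    using four False tr f by (subst card_Un_disjoint; force)+
  have Q12: "card (?Q1 \<union> ?Q2) = card ?Q1 + card ?Q2"
    using f tr by (intro card_Un_disjoint) auto
  have Q13: "card (?Q1 \<union> ?Q3) = card ?Q1 + card ?Q3"
    using f tr by (intro card_Un_disjoint) auto
  have Q23: "card (?Q2 \<union> ?Q3) = card ?Q2 + card ?Q3"
    using f tr by (intro card_Un_disjoint) auto
  have DQ: "card B \<le> k" if "B \<subseteq> D" for B using card_mono[OF D(1) that] D(2) by simp
  \<comment> \<open>One color outside \<open>D\<close> is all that is needed for
    \<open>k + 1\<close>, as \<open>D\<close> itself has \<open>k\<close>; the bound 4 is two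
    disjoint pairs with two colors each.\<close>
  have main: thesis if puv: "p = {s, t} \<union> {u, v}" and two: "2 \<le> card (L s \<inter> L t)"
    "2 \<le> card (L u \<inter> L v)" and card_eq: "card (L s \<inter> L t \<union> L u \<inter> L v) = 2 * card (L s \<inter> L t)"
    and notD: "\<not> L s \<inter> L t \<union> L u \<inter> L v \<subseteq> D" for s t u v
  proof (rule split[of "{s, t}" "{u, v}"])
    obtain c where c: "c \<in> L s \<inter> L t \<union> L u \<inter> L v" "c \<notin> D" using notD by blast
    have "card (insert c D) \<le> card (\<Inter>(L ` {s, t}) \<union> \<Inter>(L ` {u, v}) \<union> D)"
      using c D(1) p(2) puv by (intro card_mono) auto
    then show "k + 1 \<le> card (\<Inter>(L ` {s, t}) \<union> \<Inter>(L ` {u, v}) \<union> D)" using c(2) D by simp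
    have "L s \<inter> L t \<noteq> {}" "L u \<inter> L v \<noteq> {}" using two by auto
    then show "\<Inter>(L ` {s, t}) \<noteq> {}" "\<Inter>(L ` {u, v}) \<noteq> {}" by simp_all
    show "4 \<le> card (\<Inter>(L ` {s, t}) \<union> \<Inter>(L ` {u, v}))" using two(1) card_eq by simp
  qed (use puv in auto)
  have four': "card (L w \<inter> L x) + card (L w \<inter> L y) + card (L w \<inter> L z) = k"
    "card (L w \<inter> L x) = card (L y \<inter> L z)" "card (L w \<inter> L y) = card (L x \<inter> L z)"
    "card (L w \<inter> L z) = card (L x \<inter> L y)" using four False by blast+
  have "2 \<le> card (L w \<inter> L x) \<and> \<not> ?Q1 \<subseteq> D \<or> 2 \<le> card (L w \<inter> L y) \<and> \<not> ?Q2 \<subseteq> D \<or>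
      2 \<le> card (L w \<inter> L z) \<and> \<not> ?Q3 \<subseteq> D"
  proof (rule two_le_unless_small_sums[OF four'(1) k])
    show "2 * card (L w \<inter> L x) \<le> k" if "?Q1 \<subseteq> D" using DQ[OF that] Q by simp
    show "2 * card (L w \<inter> L y) \<le> k" if "?Q2 \<subseteq> D" using DQ[OF that] Q by simp
    show "2 * card (L w \<inter> L z) \<le> k" if "?Q3 \<subseteq> D" using DQ[OF that] Q by simp
    show "2 * (card (L w \<inter> L x) + card (L w \<inter> L y)) \<le> k" if "?Q1 \<subseteq> D" "?Q2 \<subseteq> D"
      using DQ[OF Un_least[OF that]] Q Q12 by simp
    show "2 * (card (L w \<inter> L x) + card (L w \<inter> L z)) \<le> k" if "?Q1 \<subseteq> D" "?Q3 \<subseteq> D"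
      using DQ[OF Un_least[OF that]] Q Q13 by simp
    show "2 * (card (L w \<inter> L y) + card (L w \<inter> L z)) \<le> k" if "?Q2 \<subseteq> D" "?Q3 \<subseteq> D"
      using DQ[OF Un_least[OF that]] Q Q23 by simp
  qed
  then consider "2 \<le> card (L w \<inter> L x)" "\<not> ?Q1 \<subseteq> D" | "2 \<le> card (L w \<inter> L y)" "\<not> ?Q2 \<subseteq> D"
    | "2 \<le> card (L w \<inter> L z)" "\<not> ?Q3 \<subseteq> D" by blast
  then show ?thesis
  proof cases
    case 1
    show ?thesis
      by (rule main[of w x y z]) (use 1 four' Q wxyz(1) in auto)
  next
    case 2
    show ?thesis
      by (rule main[of w y x z]) (use 2 four' Q wxyz(1) in auto)
  next
    case 3
    show ?thesis
      by (rule main[of w z x y]) (use 3 four' Q wxyz(1) in auto)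
  qed
qed

section \<open>Families with few large parts\<close>

text \<open>This class contains the graphs of the theorem and is closed both under induced subgraphs and, with \<open>k - 1\<close>
  for \<open>k\<close>, under the removal of a part with at least two vertices. It bounds the number of vertices
  by \<open>2 * k + 1\<close>.\<close>

definition few_large_parts :: "nat \<Rightarrow> 'i set \<Rightarrow> ('i \<Rightarrow> 'a set) \<Rightarrow> bool" where
  "few_large_parts k I X \<longleftrightarrow> finite I \<and> disjoint_family_on X I \<and>
     (\<forall>i\<in>I. finite (X i) \<and> card (X i) \<le> 4) \<and> card I \<le> k \<and>
     card {i\<in>I. 2 \<le> card (X i)} + 3 \<le> k \<and> card {i\<in>I. 3 \<le> card (X i)} \<le> 3 \<and>
     card {i\<in>I. 4 \<le> card (X i)} \<le> 1"

lemma few_large_parts_restrict: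
  assumes "few_large_parts k I X"
  shows "few_large_parts k I (\<lambda>i. X i \<inter> S)"
proof -
  have fin: "finite I" "\<And>i. i \<in> I \<Longrightarrow> finite (X i)"
    using assms unfolding few_large_parts_def by auto
  have le: "card (X i \<inter> S) \<le> card (X i)" if "i \<in> I" for i
    using fin(2)[OF that] by (intro card_mono) auto
  have sub: "card {i\<in>I. m \<le> card (X i \<inter> S)} \<le> card {i\<in>I. m \<le> card (X i)}" for m
    using fin(1) le by (intro card_mono) (auto intro: order_trans)
  have "card (X i \<inter> S) \<le> 4" if "i \<in> I" for i
    using le[OF that] assms that unfolding few_large_parts_def by (meson order_trans)
  moreover have "disjoint_family_on (\<lambda>i. X i \<inter> S) I"
    using assms unfolding few_large_parts_def disjoint_family_on_def by blast
  ultimately show ?thesis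
    using assms sub[of 2] sub[of 3] sub[of 4] unfolding few_large_parts_def by auto
qed

text \<open>The removed part is counted in both bounds that depend on \<open>k\<close>, so both
  survive the step to \<open>k - 1\<close>.\<close>

lemma few_large_parts_remove:
  assumes "few_large_parts k I X" "i \<in> I" "2 \<le> card (X i)"
  shows "few_large_parts (k - 1) (I - {i}) X"
proof -
  have fin: "finite I" using assms unfolding few_large_parts_def by auto
  have sub: "card {j\<in>I - {i}. m \<le> card (X j)} \<le> card {j\<in>I. m \<le> card (X j)}" for m
    using fin by (intro card_mono) auto
  have "{j\<in>I - {i}. 2 \<le> card (X j)} = {j\<in>I. 2 \<le> card (X j)} - {i}" by auto
  moreover have "card ({j\<in>I. 2 \<le> card (X j)} - {i}) < card {j\<in>I. 2 \<le> card (X j)}"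
    using assms fin by (intro card_Diff1_less) auto
  moreover have "card (I - {i}) < card I" using assms(2) fin by (intro card_Diff1_less)
  moreover have "disjoint_family_on X (I - {i})"
    using assms(1) unfolding few_large_parts_def disjoint_family_on_def by blast
  ultimately show ?thesis
    using assms(1) sub[of 3] sub[of 4] fin unfolding few_large_parts_def by auto
qed

text \<open>A part of size \<open>n\<close> is counted once for each threshold from 1 to
  \<open>n\<close>. For a family with few large parts the four terms are at most \<open>k\<close>,
  \<open>k - 3\<close>, 3 and 1.\<close>

lemma card_parts_eq:
  assumes "finite I" "disjoint_family_on X I" "\<And>i. i \<in> I \<Longrightarrow> finite (X i) \<and> card (X i) \<le> 4"
  shows "card (\<Union>(X ` I)) = card {i\<in>I. 1 \<le> card (X i)} + card {i\<in>I. 2 \<le> card (X i)} +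
    card {i\<in>I. 3 \<le> card (X i)} + card {i\<in>I. 4 \<le> card (X i)}"
proof -
  have "card (\<Union>(X ` I)) = (\<Sum>i\<in>I. card (X i))"
    using assms unfolding disjoint_family_on_def by (intro card_UN_disjoint) auto
  also have "\<dots> = (\<Sum>i\<in>I. of_bool (1 \<le> card (X i)) + of_bool (2 \<le> card (X i)) +
      of_bool (3 \<le> card (X i)) + of_bool (4 \<le> card (X i)))"
  proof (rule sum.cong)
    have "n = of_bool (1 \<le> n) + of_bool (2 \<le> n) + of_bool (3 \<le> n) + of_bool (4 \<le> n)"
      if "n \<le> 4" for n :: nat
    proof -
      have "n \<in> {0, 1, 2, 3, 4}" using that by auto
      then show ?thesis by auto
    qed
    then show "card (X i) = of_bool (1 \<le> card (X i)) + of_bool (2 \<le> card (X i)) +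
      of_bool (3 \<le> card (X i)) + of_bool (4 \<le> card (X i))" if "i \<in> I" for i
      using assms(3)[OF that] by blast
  qed simp
  also have "\<dots> = card {i\<in>I. 1 \<le> card (X i)} + card {i\<in>I. 2 \<le> card (X i)} +
    card {i\<in>I. 3 \<le> card (X i)} + card {i\<in>I. 4 \<le> card (X i)}"
    using assms(1) by (simp add: sum.distrib sum_of_bool_eq Int_def)
  finally show ?thesis .
qed

text \<open>Splitting one vertex off from every part of size three or four is enough here; the parts
  outside \<open>?H\<close> have at most one vertex.\<close>

lemma parts_colorable_few_colors:
  fixes L :: "'a \<Rightarrow> 'c set"
  assumes fam: "few_large_parts k I X"
    and L: "\<forall>v\<in>\<Union>(X ` I). finite (L v) \<and> card (L v) = k"
    and common: "\<And>i. i \<in> I \<Longrightarrow> 2 \<le> card (X i) \<Longrightarrow> \<Inter>(L ` X i) = {}"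
    and no2: "\<And>i. i \<in> I \<Longrightarrow> card (X i) \<noteq> 2"
    and few: "card (\<Union>(L ` \<Union>(X ` I))) < 2 * k"
  shows "parts_colorable I X L"
proof -
  let ?C = "\<Union>(L ` \<Union>(X ` I))" and ?H = "{i\<in>I. 3 \<le> card (X i)}"
  have fin: "finite I" "\<And>i. i \<in> I \<Longrightarrow> finite (X i)" and disj: "disjoint_family_on X I"
    and le4: "\<And>i. i \<in> I \<Longrightarrow> card (X i) \<le> 4" and Ik: "card I \<le> k"
    using fam unfolding few_large_parts_def by auto
  have finC: "finite ?C" using fin L by auto
  have Xi: "\<forall>v\<in>X i. finite (L v) \<and> card (L v) = k" if "i \<in> I" for i using L that by blast
  have Ci: "card (\<Union>(L ` X i)) < 2 * k" if "i \<in> I" for i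
  proof -
    have "card (\<Union>(L ` X i)) \<le> card ?C" using finC that by (intro card_mono) auto
    then show ?thesis using few by linarith
  qed
  have "card ?H \<le> card {i\<in>I. 2 \<le> card (X i)}" using fin(1) by (intro card_mono) auto
  then have h: "card ?H \<le> 3" "card ?H + 3 \<le> k" using fam unfolding few_large_parts_def by auto
  \<comment> \<open>\<open>a\<close> is the part of size four if there is one, and arbitrary
    otherwise.\<close>
  have "\<exists>a. {i\<in>I. 4 \<le> card (X i)} \<subseteq> {a}"
  proof -
    have "card {i\<in>I. 4 \<le> card (X i)} \<le> 1" "finite {i\<in>I. 4 \<le> card (X i)}"
      using fam unfolding few_large_parts_def by auto
    then have eq: "i = j" if "i \<in> {i\<in>I. 4 \<le> card (X i)}" "j \<in> {i\<in>I. 4 \<le> card (X i)}" for i j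
      using that by (simp add: card_le_Suc0_iff_eq)
    show ?thesis
    proof (cases "{i\<in>I. 4 \<le> card (X i)} = {}")
      case True
      then have "{i\<in>I. 4 \<le> card (X i)} \<subseteq> {undefined}" by (simp only: empty_subsetI)
      then show ?thesis by (rule exI)
    next
      case False
      then obtain j where "j \<in> {i\<in>I. 4 \<le> card (X i)}" by blast
      then have "{i\<in>I. 4 \<le> card (X i)} \<subseteq> {j}" using eq by (intro subsetI) simp
      then show ?thesis by (rule exI)
    qed
  qed
  then obtain a where a: "{i\<in>I. 4 \<le> card (X i)} \<subseteq> {a}" by (elim exE)
  have "\<exists>z\<in>X i. \<Inter>(L ` (X i - {z})) \<noteq> {} \<and> (i \<noteq> a \<longrightarrow> card ?H \<le> card (\<Inter>(L ` (X i - {z}))))"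
    if i: "i \<in> ?H" for i
  proof (cases "card (X i) = 3")
    case True
    have iI: "i \<in> I" using i by blast
    have "\<Inter>(L ` X i) = {}" using common[OF iI] True by simp
    \<comment> \<open>With \<open>h = card ?H\<close>, the bounds \<open>h \<le> 3\<close> and
      \<open>h + 3 \<le> k\<close> give \<open>3 * h \<le> k + 3\<close>, and fewer than
      \<open>2 * k\<close> colors occur.\<close>
    moreover have "card (\<Union>(L ` X i)) + 3 * card ?H < 3 * k + 3" using Ci[OF iI] h by linarith
    ultimately obtain z where z: "z \<in> X i" "card ?H \<le> card (\<Inter>(L ` (X i - {z})))"
      using exists_large_pair_class[OF True Xi[OF iI]] by blast
    have "card ?H \<noteq> 0" using i fin(1) by auto
    then have "\<Inter>(L ` (X i - {z})) \<noteq> {}" using z(2) by (intro notI) simp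
    then show ?thesis using z by (intro bexI[of _ z] conjI impI)
  next
    case False
    have "i \<in> I" "3 \<le> card (X i)" using i by blast+
    then have i4: "i \<in> I" "card (X i) = 4" using False le4[of i] by linarith+
    then have "i \<in> {a}" using a by (intro subsetD[OF a]) simp
    then have "i = a" by simp
    obtain w x y z where "X i = {w, x, y, z}" "distinct [w, x, y, z]"
      using card_4_distinct[OF i4(2)] by blast
    \<comment> \<open>Without a common color of three vertices, this part alone would see
      \<open>2 * k\<close> colors.\<close>
    then have "\<not> (\<forall>v\<in>X i. \<Inter>(L ` (X i - {v})) = {})"
      using four_part_no_triple(1)[of "X i" w x y z L k] Xi[OF i4(1)] Ci[OF i4(1)] by linarith
    then show ?thesis using \<open>i = a\<close> by blast
  qed
  then have "\<forall>i\<in>?H. \<exists>z. z \<in> X i \<and> \<Inter>(L ` (X i - {z})) \<noteq> {} \<and>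
      (i \<noteq> a \<longrightarrow> card ?H \<le> card (\<Inter>(L ` (X i - {z}))))" by blast
  from bchoice[OF this] obtain z where z': "\<forall>i\<in>?H. z i \<in> X i \<and> \<Inter>(L ` (X i - {z i})) \<noteq> {} \<and>
      (i \<noteq> a \<longrightarrow> card ?H \<le> card (\<Inter>(L ` (X i - {z i}))))" ..
  have z: "\<And>i. i \<in> ?H \<Longrightarrow> z i \<in> X i" "\<And>i. i \<in> ?H \<Longrightarrow> \<Inter>(L ` (X i - {z i})) \<noteq> {}"
    "\<And>i. i \<in> ?H - {a} \<Longrightarrow> card ?H \<le> card (\<Inter>(L ` (X i - {z i})))"
    using z' by blast+
  define K where "K i = (if i \<in> ?H then {X i - {z i}, {z i}} else (\<lambda>v. {v}) ` X i)" for i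
  show ?thesis
  proof (rule parts_colorable_if_classes[OF disj, of K])
    show K: "\<Union>(K i) = X i" "{} \<notin> K i" if "i \<in> I" for i
    proof -
      have "X i - {z i} \<noteq> {}" if "i \<in> ?H"
      proof
        assume "X i - {z i} = {}"
        then have "card (X i) \<le> card {z i}" by (intro card_mono) auto
        then show False using that by simp
      qed
      then show "\<Union>(K i) = X i" "{} \<notin> K i" using z(1)[of i] unfolding K_def by auto
    qed
    show "finite (\<Union>(X ` I))" using fin by blast
    show "finite (L v)" if "v \<in> \<Union>(X ` I)" for v using L that by blast
    fix S assume S: "S \<subseteq> \<Union>(K ` I)"
    have A: "finite (\<Inter>(L ` q))" if q: "q \<in> \<Union>(K ` I)" for q
    proof -
      obtain i where i: "i \<in> I" "q \<in> K i" using q by blast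
      then obtain v where "v \<in> q" using K(2) by fastforce
      moreover from this have "finite (L v)" using Xi[OF i(1)] K(1)[OF i(1)] i(2) by blast
      ultimately show ?thesis by (meson INT_lower finite_subset)
    qed
    show "card S \<le> card (\<Union>q\<in>S. \<Inter>(L ` q))"
    proof (rule hall_few_colors[where H = ?H and R = "\<lambda>i. X i - {z i}" and Z = "\<lambda>i. {z i}" and a = a,
          OF fin(1) Ik _ _ _ _ _ _ _ _ A S])
      fix i assume i: "i \<in> I - ?H"
      then have "card (X i) \<le> 1" using no2[of i] by auto
      then show "finite (K i) \<and> card (K i) \<le> 1"
        using i fin(2)[of i] card_image_le[OF fin(2)[of i], of "\<lambda>v. {v}"] unfolding K_def by auto
      show "k \<le> card (\<Inter>(L ` q))" if "q \<in> K i" for q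
        using that i Xi[of i] unfolding K_def by auto
    next
      fix i assume i: "i \<in> ?H"
      show "K i = {X i - {z i}, {z i}}" using i unfolding K_def by simp
      show "k \<le> card (\<Inter>(L ` {z i}))" using Xi[of i] z(1)[OF i] i by simp
      show "\<Inter>(L ` (X i - {z i})) \<inter> \<Inter>(L ` {z i}) = {}"
        using Inter_part_disjoint[of L "X i" "z i"] common[of i] z(1)[OF i] i by simp
      show "\<Inter>(L ` (X i - {z i})) \<noteq> {}" using z(2)[OF i] .
    qed (use z(3) in auto)
  qed
qed

lemma parts_colorable_many_colors:
  fixes L :: "'a \<Rightarrow> 'c set"
  assumes fam: "few_large_parts k I X"
    and L: "\<forall>v\<in>\<Union>(X ` I). finite (L v) \<and> card (L v) = k"
    and common: "\<And>i. i \<in> I \<Longrightarrow> 2 \<le> card (X i) \<Longrightarrow> \<Inter>(L ` X i) = {}"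
    and many: "2 * k \<le> card (\<Union>(L ` \<Union>(X ` I)))"
    and less: "card (\<Union>(L ` \<Union>(X ` I))) < card (\<Union>(X ` I))"
  shows "parts_colorable I X L"
proof -
  let ?C = "\<Union>(L ` \<Union>(X ` I))" and ?G = "\<lambda>m. {i\<in>I. m \<le> card (X i)}"
  have fin: "finite I" "\<And>i. i \<in> I \<Longrightarrow> finite (X i)" and disj: "disjoint_family_on X I"
    and le4: "\<And>i. i \<in> I \<Longrightarrow> card (X i) \<le> 4" and Ik: "card I \<le> k"
    and G: "card (?G 2) + 3 \<le> k" "card (?G 3) \<le> 3" "card (?G 4) \<le> 1"
    using fam unfolding few_large_parts_def by auto
  have finC: "finite ?C" using fin L by auto
  have "card (?G 1) \<le> card I" using fin(1) by (intro card_mono) auto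
  moreover have "card (\<Union>(X ` I)) = card (?G 1) + card (?G 2) + card (?G 3) + card (?G 4)"
    using fin le4 disj by (intro card_parts_eq) auto
  ultimately have sizes: "card (?G 1) = k" "card (?G 2) + 3 = k" "card (?G 3) = 3" "card (?G 4) = 1"
    "card ?C = 2 * k"
    using Ik G many less by linarith+
  have "card (?G 3) \<le> card (?G 2)" using fin(1) by (intro card_mono) auto
  then have k6: "6 \<le> k" using sizes by linarith
  obtain a where Ga: "?G 4 = {a}" using sizes(4) by (rule card_1_singletonE)
  have "a \<in> ?G 4" using Ga by blast
  then have aI: "a \<in> I" "card (X a) = 4" using le4[of a] by auto
  have "card (?G 3 - {a}) = 2" using sizes(3) aI by simp
  then obtain b c where bc: "?G 3 - {a} = {b, c}" "b \<noteq> c" by (meson card_2_iff)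
  have "a \<in> ?G 3" using aI by simp
  then have G3: "?G 3 = {a, b, c}" using bc(1) by (metis insert_Diff)
  have three: "i \<in> I \<and> card (X i) = 3 \<and> i \<noteq> a" if "i \<in> {b, c}" for i
  proof -
    have "i \<in> ?G 3" "i \<noteq> a" using that bc(1) by blast+
    then have "i \<in> I" "3 \<le> card (X i)" by simp_all
    moreover have "i \<notin> ?G 4" unfolding Ga using \<open>i \<noteq> a\<close> by simp
    then have "\<not> 4 \<le> card (X i)" using \<open>i \<in> I\<close> by simp
    ultimately show ?thesis using \<open>i \<noteq> a\<close> by simp
  qed
  have bI: "b \<in> I" "card (X b) = 3" "b \<noteq> a" and cI: "c \<in> I" "card (X c) = 3" "c \<noteq> a"
    using three[of b] three[of c] by simp_all
  \<comment> \<open>There are \<open>k\<close> nonempty parts but only \<open>k - 3\<close> with two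
    or more vertices, so a part of size one exists; its list plays the role of \<open>D\<close> in
    the splitting of \<open>X a\<close>.\<close>
  have "\<not> ?G 1 \<subseteq> ?G 2"
  proof
    assume "?G 1 \<subseteq> ?G 2"
    then have "card (?G 1) \<le> card (?G 2)" using fin(1) by (intro card_mono) simp_all
    then show False using sizes(1,2) by linarith
  qed
  then obtain s where "s \<in> ?G 1" "s \<notin> ?G 2" by blast
  then have s: "s \<in> I" "card (X s) = 1" by simp_all
  then obtain t where t: "X s = {t}" by (meson card_1_singletonE)
  have Xi: "\<forall>v\<in>X i. finite (L v) \<and> card (L v) = k" if "i \<in> I" for i using L that by blast
  have Ci: "card (\<Union>(L ` X i)) \<le> 2 * k" if "i \<in> I" for i
    unfolding sizes(5)[symmetric] using finC that by (intro card_mono) auto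
  have Lt: "finite (L t)" "card (L t) = k" using Xi[OF s(1)] t by auto
  have com: "\<Inter>(L ` X a) = {}" "\<Inter>(L ` X b) = {}" "\<Inter>(L ` X c) = {}"
    using common aI bI cI by simp_all
  obtain r q where rq: "r \<union> q = X a" "r \<noteq> {}" "q \<noteq> {}" "\<Inter>(L ` r) \<noteq> {}" "\<Inter>(L ` q) \<noteq> {}"
    "4 \<le> card (\<Inter>(L ` r) \<union> \<Inter>(L ` q))" "k + 1 \<le> card (\<Inter>(L ` r) \<union> \<Inter>(L ` q) \<union> L t)"
    using exists_split_4_part[OF aI(2) Xi[OF aI(1)] com(1) Ci[OF aI(1)] Lt k6] .
  obtain y z where yz: "y \<in> X b" "z \<in> X c" "2 \<le> card (\<Inter>(L ` (X b - {y})))" "2 \<le> card (\<Inter>(L ` (X c - {z})))"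
    "3 \<le> card (\<Inter>(L ` (X b - {y})) \<union> \<Inter>(L ` (X c - {z})))"
    "k + 3 \<le> card (\<Inter>(L ` (X b - {y})) \<union> L y \<union> (\<Inter>(L ` (X c - {z})) \<union> L z))"
    using exists_good_pair_classes[OF bI(2) Xi[OF bI(1)] com(2) Ci[OF bI(1)]
        cI(2) Xi[OF cI(1)] com(3) Ci[OF cI(1)] k6] .
  define K where "K i = (if i = a then {r, q} else if i = b then {X b - {y}, {y}} else
      if i = c then {X c - {z}, {z}} else (\<lambda>v. {v}) ` X i)" for i
  have Ka: "K a = {r, q}" and Kb: "K b = {X b - {y}, {y}}" and Kc: "K c = {X c - {z}, {z}}"
    unfolding K_def using bI cI bc(2) by auto
  have Ki: "K i = (\<lambda>v. {v}) ` X i" if "i \<notin> {a, b, c}" for i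
    unfolding K_def using that by auto
  have le2: "card (X i) \<le> 2" if "i \<in> I - {a, b, c}" for i
  proof -
    have "i \<notin> ?G 3" unfolding G3 using that by blast
    then show ?thesis using that by auto
  qed
  have cardKi: "finite (K i) \<and> card (K i) = card (X i)" if "i \<in> I - {a, b, c}" for i
    using that fin(2)[of i] Ki[of i] by (simp add: card_image)
  have cardK: "finite (K i) \<and> card (K i) \<le> 2" if "i \<in> I" for i
    using cardKi[of i] le2[of i] Ka Kb Kc that by (cases "i \<in> {a, b, c}") (auto simp: card_insert_if)
  have "s \<notin> {a, b, c}" using s aI bI cI by auto
  \<comment> \<open>Only parts with at least two vertices have two classes. The bound is compared
    with the \<open>2 * k\<close> colors on two vertices with disjoint lists.\<close>
  have J: "card (\<Union>(K ` I)) \<le> 2 * k"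
  proof -
    have "card (\<Union>(K ` I)) \<le> card I + card {i\<in>I. card (K i) = 2 \<and> K i \<subseteq> \<Union>(K ` I)}"
      by (rule card_le_index_plus_full[OF fin(1) cardK subset_refl])
    also have "{i\<in>I. card (K i) = 2 \<and> K i \<subseteq> \<Union>(K ` I)} \<subseteq> ?G 2"
    proof
      fix i assume i: "i \<in> {i\<in>I. card (K i) = 2 \<and> K i \<subseteq> \<Union>(K ` I)}"
      then show "i \<in> ?G 2" using aI bI cI cardKi[of i] by (cases "i \<in> {a, b, c}") auto
    qed
    then have "card {i\<in>I. card (K i) = 2 \<and> K i \<subseteq> \<Union>(K ` I)} \<le> card (?G 2)"
      using fin(1) by (intro card_mono) auto
    finally show ?thesis using Ik G(1) by linarith
  qed
  show ?thesis
  proof (rule parts_colorable_if_classes[OF disj, of K])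
    show K: "\<Union>(K i) = X i" "{} \<notin> K i" if "i \<in> I" for i
    proof -
      have "X b - {y} \<noteq> {}" "X c - {z} \<noteq> {}"
        using bI(2) cI(2) yz(1,2) by (auto simp: card_insert_if subset_singleton_iff Diff_eq_empty_iff)
      then show "\<Union>(K i) = X i" "{} \<notin> K i" using rq(1-3) yz(1,2) unfolding K_def by auto
    qed
    show "finite (\<Union>(X ` I))" using fin by blast
    show "finite (L v)" if "v \<in> \<Union>(X ` I)" for v using L that by blast
    fix S assume S: "S \<subseteq> \<Union>(K ` I)"
    have A: "finite (\<Inter>(L ` q))" if q: "q \<in> \<Union>(K ` I)" for q
    proof -
      obtain i where i: "i \<in> I" "q \<in> K i" using q by blast
      then obtain v where "v \<in> q" using K(2) by fastforce
      moreover from this have "finite (L v)" using Xi[OF i(1)] K(1)[OF i(1)] i(2) by blast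
      ultimately show ?thesis by (meson INT_lower finite_subset)
    qed
    show "card S \<le> card (\<Union>q\<in>S. \<Inter>(L ` q))"
    proof (rule hall_many_colors[where K = K and A = "\<lambda>q. \<Inter>(L ` q)" and t = "{t}",
          OF fin(1) Ik _ \<open>s \<notin> {a, b, c}\<close> _ _ _ _ Ka rq(4-6) _ Kb yz(3) _ _ Kc yz(4) _ _ yz(5) _ A S])
      show "{a, b, c, s} \<subseteq> I" using aI bI cI s by blast
      show "K s = {{t}}" using Ki \<open>s \<notin> {a, b, c}\<close> t by simp
      show "k + 1 \<le> card (\<Inter>(L ` r) \<union> \<Inter>(L ` q) \<union> \<Inter>(L ` {t}))" using rq(7) by simp
      show "k \<le> card (\<Inter>(L ` {y}))" "k \<le> card (\<Inter>(L ` {z}))" using Xi bI(1) cI(1) yz(1,2) by auto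
      show "\<Inter>(L ` (X b - {y})) \<inter> \<Inter>(L ` {y}) = {}" "\<Inter>(L ` (X c - {z})) \<inter> \<Inter>(L ` {z}) = {}"
        using Inter_part_disjoint[OF com(2) yz(1)] Inter_part_disjoint[OF com(3) yz(2)] by simp_all
      show "k + 3 \<le> card (\<Inter>(L ` (X b - {y})) \<union> \<Inter>(L ` {y}) \<union> (\<Inter>(L ` (X c - {z})) \<union> \<Inter>(L ` {z})))"
        using yz(6) by simp
    next
      fix i assume i: "i \<in> I - {a, b, c}"
      show "finite (K i) \<and> card (K i) \<le> 2" using cardK i by blast
      show "k \<le> card (\<Inter>(L ` q))" if "q \<in> K i" for q
        using that i Xi[of i] Ki[of i] by auto
      assume K2: "card (K i) = 2"
      then obtain u v where uv: "X i = {u, v}" "u \<noteq> v" using cardKi[OF i] by (metis card_2_iff)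
      have "\<Inter>(L ` X i) = {}" using common[of i] K2 cardKi[OF i] i by simp
      then have "card (L u \<union> L v) = card (L u) + card (L v)"
        using Xi[of i] i uv by (intro card_Un_disjoint) auto
      moreover have "card (L u) = k" "card (L v) = k" using Xi[of i] i uv by auto
      moreover have "(\<Union>q\<in>K i. \<Inter>(L ` q)) = L u \<union> L v" using Ki[of i] i uv by auto
      ultimately show "card (\<Union>(K ` I)) \<le> card (\<Union>q\<in>K i. \<Inter>(L ` q))" using J by simp
    qed
  qed
qed

theorem parts_colorable_if_few_large_parts:
  fixes L :: "'a \<Rightarrow> 'c set"
  assumes "few_large_parts k I X" "\<forall>v\<in>\<Union>(X ` I). finite (L v) \<and> card (L v) = k"
  shows "parts_colorable I X L"
  using assms
\<comment> \<open>Two reductions lower the number of vertices: restricting all parts to a vertex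
  subset keeps \<open>k\<close>, and deleting a part lowers \<open>k\<close> by one and changes
  \<open>I\<close> and \<open>L\<close>. Hence all of these vary.\<close>
proof (induction "card (\<Union>(X ` I))" arbitrary: k I X L rule: less_induct)
  case less
  let ?W = "\<Union>(X ` I)"
  note fam = less.prems(1) and L = less.prems(2)
  have fin: "finite I" "\<And>i. i \<in> I \<Longrightarrow> finite (X i)" and disj: "disjoint_family_on X I" and k: "3 \<le> k"
    using fam unfolding few_large_parts_def by auto
  then have finW: "finite ?W" by blast
  show ?case
  proof (rule ccontr)
    assume nc: "\<not> parts_colorable I X L"
    have restrict: "parts_colorable I (\<lambda>i. X i \<inter> S) L" if "S \<subset> ?W" for S
    proof (rule less.hyps[OF _ few_large_parts_restrict[OF fam]])
      have "(\<Union>i\<in>I. X i \<inter> S) \<subset> ?W" using that by blast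
      then show "card (\<Union>i\<in>I. X i \<inter> S) < card ?W" using finW by (rule psubset_card_mono[rotated])
    qed (use L in auto)
    have lt: "card (\<Union>(L ` ?W)) < card ?W"
      using disj finW L nc restrict by (intro card_colors_less) auto
    have common: "\<Inter>(L ` X i) = {}" if i: "i \<in> I" "2 \<le> card (X i)" for i
    proof (rule ccontr)
      assume "\<Inter>(L ` X i) \<noteq> {}"
      then obtain c where c: "\<And>v. v \<in> X i \<Longrightarrow> c \<in> L v" by blast
      \<comment> \<open>Lists without \<open>c\<close> have size \<open>k\<close> or
        \<open>k - 1\<close>; they are cut to exactly \<open>k - 1\<close> to fit the induction
        hypothesis.\<close>
      have "\<exists>B\<subseteq>L v - {c}. card B = k - 1" if "v \<in> ?W" for v
      proof -
        have "k - 1 \<le> card (L v - {c})" using L that by (auto simp: card_Diff_singleton_if)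
        then show ?thesis by (meson obtain_subset_with_card_n)
      qed
      then obtain L' where L': "\<And>v. v \<in> ?W \<Longrightarrow> L' v \<subseteq> L v - {c}" "\<And>v. v \<in> ?W \<Longrightarrow> card (L' v) = k - 1"
        by metis
      have "parts_colorable (I - {i}) X L'"
      proof (rule less.hyps[OF _ few_large_parts_remove[OF fam i]])
        obtain v where v: "v \<in> X i" using i by fastforce
        then have "v \<notin> \<Union>(X ` (I - {i}))" using disj i(1) by (auto simp: disjoint_family_on_def)
        then have "\<Union>(X ` (I - {i})) \<subset> ?W" using v i(1) by blast
        then show "card (\<Union>(X ` (I - {i}))) < card ?W" using finW by (rule psubset_card_mono[rotated])
        have "finite (L' v)" if "v \<in> ?W" for v
          using L'(1)[OF that] L that by (meson finite_Diff finite_subset)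
        then show "\<forall>v\<in>\<Union>(X ` (I - {i})). finite (L' v) \<and> card (L' v) = k - 1" using L'(2) by blast
      qed
      then have "parts_colorable (I - {i}) X (\<lambda>v. L v - {c})"
        by (rule parts_colorable_mono) (use L'(1) in blast)
      then have "parts_colorable I X L"
        using c disj i(1) by (rule parts_colorable_remove_part)
      with nc show False ..
    qed
    show False
    proof (cases "2 * k \<le> card (\<Union>(L ` ?W))")
      case True
      then show ?thesis using parts_colorable_many_colors[OF fam L common _ lt] nc by blast
    next
      case False
      have "card (X i) \<noteq> 2" if i: "i \<in> I" for i
      proof
        assume X2: "card (X i) = 2"
        then obtain u v where uv: "X i = {u, v}" "u \<noteq> v" by (meson card_2_iff)
        have "finite (L u)" "finite (L v)" "card (L u) = k" "card (L v) = k" using L i uv by auto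
        moreover have "L u \<inter> L v = {}" using common[OF i] X2 uv by simp
        ultimately have "card (L u \<union> L v) = 2 * k" by (simp add: card_Un_disjoint)
        moreover have "L u \<union> L v \<subseteq> \<Union>(L ` ?W)" using uv i by auto
        moreover have "finite (\<Union>(L ` ?W))" using finW by (rule finite_UN_I) (use L in blast)
        ultimately show False using False card_mono by metis
      qed
      then show ?thesis using parts_colorable_few_colors[OF fam L common] nc False by (meson not_le)
    qed
  qed
qed

section \<open>From colorings of parts to the choice number\<close>

lemma not_choosable_less_parts:
  assumes P: "partition_on V P" "finite P"
    and E: "\<And>u v. u \<in> V \<Longrightarrow> v \<in> V \<Longrightarrow> {u, v} \<in> E \<longleftrightarrow> \<not> (\<exists>p\<in>P. u \<in> p \<and> v \<in> p)"
    and ch: "choosable V E j"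
  shows "card P \<le> j"
proof -
  \<comment> \<open>With identical lists of \<open>j\<close> colors, a clique of one representative
    per part needs \<open>card P\<close> different colors.\<close>
  have "list_assignment V j (\<lambda>_. {..<j})" by (simp add: list_assignment_def)
  then obtain c where c: "list_coloring V E (\<lambda>_. {..<j}) c"
    using ch unfolding choosable_def list_colorable_def by blast
  have "\<forall>p\<in>P. \<exists>v. v \<in> p" using P(1) by (metis partition_onD3 ex_in_conv)
  then obtain f where f: "\<And>p. p \<in> P \<Longrightarrow> f p \<in> p" by metis
  have fV: "f p \<in> V" if "p \<in> P" for p using f[OF that] P(1) that by (auto simp: partition_on_def)
  have "inj_on (\<lambda>p. c (f p)) P"
  proof (rule inj_onI, rule ccontr)
    fix p q assume pq: "p \<in> P" "q \<in> P" "c (f p) = c (f q)" "p \<noteq> q"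
    have "\<not> (\<exists>r\<in>P. f p \<in> r \<and> f q \<in> r)"
    proof
      assume "\<exists>r\<in>P. f p \<in> r \<and> f q \<in> r"
      then obtain r where r: "r \<in> P" "f p \<in> r" "f q \<in> r" by blast
      have "disjoint P" using P(1) by (rule partition_onD2)
      then have "r = p" "r = q" using r f pq by (metis disjointD disjoint_iff)+
      then show False using pq(4) by simp
    qed
    then have "{f p, f q} \<in> E" using E fV pq by blast
    then show False using c fV pq unfolding list_coloring_def by blast
  qed
  moreover have "(\<lambda>p. c (f p)) ` P \<subseteq> {..<j}"
    using c fV unfolding list_coloring_def by blast
  ultimately show ?thesis using card_inj_on_le[of _ P "{..<j}"] by simp
qed

lemma choosable_if_few_large_parts:
  assumes P: "partition_on V P"
    and E: "\<And>u v. u \<in> V \<Longrightarrow> v \<in> V \<Longrightarrow> {u, v} \<in> E \<longleftrightarrow> \<not> (\<exists>p\<in>P. u \<in> p \<and> v \<in> p)"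
    and fam: "few_large_parts k P (\<lambda>p. p)"
  shows "choosable V E k"
  unfolding choosable_def
proof (intro allI impI)
  fix L assume L: "list_assignment V k L"
  \<comment> \<open>Lists may be larger than \<open>k\<close> or infinite; the induction works with
    lists of size exactly \<open>k\<close>.\<close>
  have "\<exists>B\<subseteq>L v. finite B \<and> card B = k" if "v \<in> V" for v
  proof (cases "finite (L v)")
    case True
    then have "k \<le> card (L v)" using L that unfolding list_assignment_def by blast
    then show ?thesis by (meson obtain_subset_with_card_n)
  next
    case False
    then show ?thesis by (meson infinite_arbitrarily_large)
  qed
  then obtain L' where L': "\<And>v. v \<in> V \<Longrightarrow> L' v \<subseteq> L v \<and> finite (L' v) \<and> card (L' v) = k" by metis
  have V: "\<Union>((\<lambda>p. p) ` P) = V" using P by (simp add: partition_on_def)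
  have "parts_colorable P (\<lambda>p. p) L'"
    using fam by (rule parts_colorable_if_few_large_parts) (use L' V in blast)
  then obtain c where c: "\<forall>p\<in>P. \<forall>v\<in>p. c v \<in> L' v"
    "\<forall>p\<in>P. \<forall>q\<in>P. p \<noteq> q \<longrightarrow> (\<forall>u\<in>p. \<forall>v\<in>q. c u \<noteq> c v)"
    unfolding parts_colorable_def by blast
  have part: "\<exists>p\<in>P. v \<in> p" if "v \<in> V" for v using V that by blast
  have "c u \<noteq> c v" if uv: "u \<in> V" "v \<in> V" "{u, v} \<in> E" for u v
  proof -
    obtain p q where "p \<in> P" "u \<in> p" "q \<in> P" "v \<in> q" using part uv by blast
    moreover from this have "p \<noteq> q" using E[OF uv(1,2)] uv(3) by blast
    ultimately show ?thesis using c(2) by blast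
  qed
  moreover have "c v \<in> L v" if "v \<in> V" for v using part[OF that] c(1) L'[OF that] by blast
  ultimately show "list_colorable V E L"
    unfolding list_colorable_def list_coloring_def by blast
qed

theorem theorem3p1:
  fixes V :: "'a set" and E :: "'a set set" and k :: nat
  assumes "k \<ge> 6"
    and "complete_multipartite V E
           ({#4#} + replicate_mset 2 3 + replicate_mset (k - 6) 2 + replicate_mset 3 1)"
  shows "choice_number V E = k"
proof -
  let ?M = "{#4#} + replicate_mset 2 3 + replicate_mset (k - 6) 2 + replicate_mset 3 (1::nat)"
  have "finite V" using assms(2) unfolding complete_multipartite_def simple_graph_def by (elim conjE)
  have "\<exists>P. partition_on V P \<and> image_mset card (mset_set P) = ?M \<and>
       (\<forall>u\<in>V. \<forall>v\<in>V. {u, v} \<in> E \<longleftrightarrow> \<not> (\<exists>p\<in>P. u \<in> p \<and> v \<in> p))"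
    using assms(2) unfolding complete_multipartite_def by (elim conjE)
  then obtain P where P: "partition_on V P" and M: "image_mset card (mset_set P) = ?M"
    and EP: "\<forall>u\<in>V. \<forall>v\<in>V. {u, v} \<in> E \<longleftrightarrow> \<not> (\<exists>p\<in>P. u \<in> p \<and> v \<in> p)"
    by (elim exE conjE)
  have E: "{u, v} \<in> E \<longleftrightarrow> \<not> (\<exists>p\<in>P. u \<in> p \<and> v \<in> p)" if "u \<in> V" "v \<in> V" for u v
    using EP[rule_format, OF that] .
  have finP: "finite P" using finite_elements[OF \<open>finite V\<close> P] .
  have "size (image_mset card (mset_set P)) = size ?M" using M by simp
  then have cardP: "card P = k" using finP assms(1) by simp
  have cnt: "card {p\<in>P. m \<le> card p} = size (filter_mset (\<lambda>n. m \<le> n) ?M)" for m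
  proof -
    have "filter_mset (\<lambda>n. m \<le> n) ?M = image_mset card (filter_mset (\<lambda>p. m \<le> card p) (mset_set P))"
      unfolding M[symmetric] by (simp add: filter_mset_image_mset)
    then show ?thesis using finP by simp
  qed
  have filter: "filter_mset Q (replicate_mset n x) = (if Q x then replicate_mset n x else {#})"
    for Q n and x :: nat by (induction n) auto
  have "few_large_parts k P (\<lambda>p. p)"
    unfolding few_large_parts_def
  proof (intro conjI ballI)
    show "finite P" by (rule finP)
    show "disjoint_family_on (\<lambda>p. p) P"
      using partition_onD2[OF P] by (simp add: disjoint_family_on_def disjoint_def)
    show "card P \<le> k" using cardP by simp
    \<comment> \<open>The parts with at least two vertices number
      \<open>1 + 2 + (k - 6) = k - 3\<close>, so this bound holds with equality.\<close>
    show "card {i \<in> P. 2 \<le> card i} + 3 \<le> k" unfolding cnt using assms(1) by (simp add: filter)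
    show "card {i \<in> P. 3 \<le> card i} \<le> 3" unfolding cnt by (simp add: filter)
    show "card {i \<in> P. 4 \<le> card i} \<le> 1" unfolding cnt by (simp add: filter)
    fix p assume p: "p \<in> P"
    then have "p \<subseteq> V" using P by (auto simp: partition_on_def)
    then show "finite p" using \<open>finite V\<close> by (rule finite_subset)
    have "card p \<in># image_mset card (mset_set P)" using p finP by auto
    then show "card p \<le> 4" unfolding M by (auto split: if_splits)
  qed
  then have "choosable V E k" using P E by (intro choosable_if_few_large_parts)
  moreover have "k \<le> j" if "choosable V E j" for j
    using not_choosable_less_parts[OF P finP E that] cardP by simp
  ultimately show ?thesis unfolding choice_number_def by (rule Least_equality)
qed

end
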